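(* Let $0<\alpha<\tfrac12$, let $L:\mathbb R\to(0,\infty)$ be slowly varying, and let $\mu$ be a probability measure on $\mathbb N$ with $\mu(\{n,n+1,\ldots\})\sim n^{-\alpha}L(n)$ as $n\to\infty$ and $\gcd\{n\in\mathbb N:\mu(\{n\})>0\}=1$. Assume that the renewal weights $q_n$ of $\mu$ satisfy $$q_n\sim\frac{1}{\Gamma(\alpha)\Gamma(1-\alpha)}\,\frac{n^{\alpha-1}}{L(n)}\quad\text{as }n\to\infty.$$ For $n\in\mathbb N$ let $$\mathscr M(0,n):=\max\{j\le0:\ j\text{ belongs to the ancestral lineage of }0\text{ and to the ancestral lineage of }n\}$$ (with $\max\emptyset:=-\infty$) be the most recent common ancestor of $0$ and $n$, and put $D_n:=-\mathscr M(0,n)$. Then, as $n\to\infty$, the sequence of random variables $\frac{D_n}{n}$, conditioned on the event $\{0\sim n\}$, converges in distribution to the random variable $D$ with density $$B(\alpha,1-2\alpha)^{-1}\,x^{\alpha-1}(1+x)^{\alpha-1}\,\mathrm dx,\qquad x>0.$$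
   Context: Here $\mathbb N=\{1,2,\ldots\}$, and $B(\cdot,\cdot)$ is the Euler Beta function. Between two real sequences, $f(n)\sim g(n)$ means $f(n)/g(n)\to1$; between integers, $\sim$ denotes the random equivalence relation defined next. Let $(R_i)_{i\in\mathbb Z}$ be i.i.d. with distribution $\mu$. $\mathcal G_\mu$ is the random directed graph with vertex set $\mathbb Z$ and edge set $\{(i,i-R_i):i\in\mathbb Z\}$. For $i,j\in\mathbb Z$, $i\sim j$ means that $i$ and $j$ belong to the same connected component of $\mathcal G_\mu$ (edge directions ignored). The ancestral lineage of $i$ is the set of vertices reachable from $i$ (including $i$ itself) by following directed edges, i.e. $i$, $i-R_i$, and so on. Renewal weights: $q_n:=\mathbf P(\tilde R_1+\cdots+\tilde R_j=n\text{ for some }j\ge0)$, with $\tilde R_1,\tilde R_2,\ldots$ independent with distribution $\mu$. *)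

theory Defs
  imports "HOL-Probability.Probability" "HOL-Library.Landau_Symbols"
begin

(* Slow variation at infinity. Measurability of L is not required. *)
definition slowly_varying :: "(real \<Rightarrow> real) \<Rightarrow> bool" where
  "slowly_varying L \<longleftrightarrow>
     (\<forall>x. L x > 0) \<and> (\<forall>c>0. ((\<lambda>x. L (c * x) / L x) \<longlongrightarrow> 1) at_top)"

(* q_n: the probability that a renewal process with i.i.d. increments x 0, x 1, ... of law \<mu>
   hits n (the empty sum, j = 0, included). *)
definition renewal_weight :: "nat pmf \<Rightarrow> nat \<Rightarrow> real" where
  "renewal_weight \<mu> n =
     measure (PiM (UNIV :: nat set) (\<lambda>_. measure_pmf \<mu>)) {x. \<exists>j. (\<Sum>i<j. x i) = n}"

definition graph_edges :: "(int \<Rightarrow> nat) \<Rightarrow> int rel" where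
  "graph_edges r = {(i, i - int (r i)) | i. True}"

definition same_component :: "(int \<Rightarrow> nat) \<Rightarrow> int \<Rightarrow> int \<Rightarrow> bool" where
  "same_component r i j \<longleftrightarrow> (i, j) \<in> (graph_edges r \<union> (graph_edges r)\<inverse>)\<^sup>*"

definition ancestral_lineage :: "(int \<Rightarrow> nat) \<Rightarrow> int \<Rightarrow> int set" where
  "ancestral_lineage r i = {j. (i, j) \<in> (graph_edges r)\<^sup>*}"

(* GREATEST is a genuine maximum here: a nonempty set of integers bounded above by 0. *)
definition mrca :: "(int \<Rightarrow> nat) \<Rightarrow> nat \<Rightarrow> ereal" where
  "mrca r n =
     (let S = {j. j \<le> 0 \<and> j \<in> ancestral_lineage r 0 \<and> j \<in> ancestral_lineage r (int n)}
      in if S = {} then - \<infinity> else ereal (real_of_int (GREATEST j. j \<in> S)))"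

definition mrca_depth :: "(int \<Rightarrow> nat) \<Rightarrow> nat \<Rightarrow> ereal" where
  "mrca_depth r n = - mrca r n"

end

theory Submission
  imports Defs
begin

text \<open>
  The lineages of \<open>0\<close> and \<open>n\<close> are renewal walks going down. As long as they have not met they use
  different steps, so they behave like independent walks; at their first common vertex
  they coalesce. Two independent walks from \<open>0\<close> and \<open>n\<close> both hit \<open>- k\<close> with probability
  \<open>q k * q (n + k)\<close>. Splitting this according to the first common point \<open>- e\<close>, after which both
  walks still have to go down by \<open>k - e\<close>, gives (\<open>renewal_product_convolution\<close>)
  \<open>q k * q (n + k) = (\<Sum>e\<le>k. P(D_n = e) * (q (k - e))\<^sup>2)\<close>.

  As \<open>q k\<close> is regularly varying of index \<open>\<alpha> - 1\<close> and \<open>\<alpha> < 1/2\<close>, the squares are summable, with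
  sum \<open>Q\<close> say. Summing over all \<open>k\<close> shows that \<open>0 \<sim> n\<close> has probability
  \<open>(\<Sum>k. q k * q (n + k)) / Q\<close>. Moreover, up to a small error, convolution with a summable sequence displaces
  mass only by a bounded amount, so on the scale \<open>n\<close> the conditional law of \<open>D_n\<close> is the
  normalised sequence \<open>k \<mapsto> q k * q (n + k)\<close> (\<open>normalised_partial_sum_limit\<close>).

  At \<open>k = u n\<close> this product is, relative to \<open>(q n)\<^sup>2\<close>, asymptotically
  \<open>u powr (\<alpha> - 1) * (1 + u) powr (\<alpha> - 1)\<close>. Dominated convergence, with a majorant from Potter's
  bounds, carries this over to sums (\<open>scaled_sum_limit\<close>), and the total mass is \<open>Beta \<alpha> (1 - 2 * \<alpha>)\<close>.
  Both the pointwise asymptotics and the majorant rest on regular variation of the tail of \<open>\<mu>\<close>: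
  its monotonicity is what makes the slowly varying factor converge uniformly enough.
\<close>

section \<open>Lineages of a deterministic graph\<close>

lemma lineage_step:
  "ancestral_lineage r i = insert i (ancestral_lineage r (i - int (r i)))"
proof -
  have "j \<in> ancestral_lineage r i \<longleftrightarrow> j = i \<or> j \<in> ancestral_lineage r (i - int (r i))" for j
    unfolding ancestral_lineage_def mem_Collect_eq
  proof
    assume "(i, j) \<in> (graph_edges r)\<^sup>*"
    then show "j = i \<or> (i - int (r i), j) \<in> (graph_edges r)\<^sup>*"
      by (cases rule: converse_rtranclE) (auto simp: graph_edges_def)
  next
    have "(i, i - int (r i)) \<in> graph_edges r" by (auto simp: graph_edges_def)
    then show "(i, j) \<in> (graph_edges r)\<^sup>*"
      if "j = i \<or> (i - int (r i), j) \<in> (graph_edges r)\<^sup>*"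
      using that by (auto intro: converse_rtrancl_into_rtrancl)
  qed
  then show ?thesis by blast
qed

lemma lineage_self: "i \<in> ancestral_lineage r i"
  by (simp add: ancestral_lineage_def)

lemma lineage_le: "j \<in> ancestral_lineage r i \<Longrightarrow> j \<le> i"
proof -
  assume "j \<in> ancestral_lineage r i"
  then have "(i, j) \<in> (graph_edges r)\<^sup>*" by (simp add: ancestral_lineage_def)
  then show "j \<le> i" by induction (auto simp: graph_edges_def)
qed

text \<open>A path to \<^term>\<open>j\<close> may be stopped at its first visit to \<^term>\<open>j\<close>. Since edges never point
  upwards, it uses only steps of vertices above \<^term>\<open>j\<close> until then.\<close>

lemma lineage_cong:
  assumes "j \<in> ancestral_lineage r i" and "\<And>l. j < l \<Longrightarrow> l \<le> i \<Longrightarrow> r l = r' l"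
  shows "j \<in> ancestral_lineage r' i"
proof -
  have "(i, j) \<in> (graph_edges r)\<^sup>*" using assms(1) by (simp add: ancestral_lineage_def)
  then show ?thesis using assms(2)
  proof (induction rule: converse_rtrancl_induct)
    case base
    show ?case by (rule lineage_self)
  next
    case (step y z)
    have z: "z = y - int (r y)" using step.hyps(1) by (auto simp: graph_edges_def)
    have "j \<le> z" using step.hyps(2) lineage_le by (simp add: ancestral_lineage_def)
    have IH: "j \<in> ancestral_lineage r' z" using step z by auto
    show ?case
    proof (cases "y = j")
      case True
      then show ?thesis by (simp add: lineage_self)
    next
      case False
      then have "r y = r' y" using \<open>j \<le> z\<close> z step.prems by force
      then show ?thesis using IH z lineage_step[of r' y] by auto
    qed
  qed
qed

text \<open>Every vertex has exactly one outgoing edge. Crossing an edge, in either direction, therefore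
  changes a lineage only by its first vertex. Having a common ancestor survives the crossing: if the
  vertex lost was the common one, its parent is common as well.\<close>

lemma same_component_iff_common_ancestor:
  "same_component r i j \<longleftrightarrow> ancestral_lineage r i \<inter> ancestral_lineage r j \<noteq> {}"
proof
  assume "same_component r i j"
  then have "(i, j) \<in> (graph_edges r \<union> (graph_edges r)\<inverse>)\<^sup>*"
    by (simp add: same_component_def)
  then show "ancestral_lineage r i \<inter> ancestral_lineage r j \<noteq> {}"
  proof (induction rule: rtrancl_induct)
    case base
    then show ?case using lineage_self by blast
  next
    case (step y z)
    then obtain c where c: "c \<in> ancestral_lineage r i" "c \<in> ancestral_lineage r y" by blast
    have "z = y - int (r y) \<or> y = z - int (r z)"
      using step.hyps by (auto simp: graph_edges_def)
    then show ?case
    proof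
      assume z: "z = y - int (r y)"
      then have yz: "ancestral_lineage r y = insert y (ancestral_lineage r z)"
        using lineage_step[of r y] by simp
      show ?thesis
      proof (cases "c = y")
        case True
        have "z \<in> ancestral_lineage r i"
          using c(1) True z unfolding ancestral_lineage_def
          by (auto intro: rtrancl_into_rtrancl simp: graph_edges_def)
        then show ?thesis using lineage_self by blast
      next
        case False
        then show ?thesis using c yz by blast
      qed
    next
      assume "y = z - int (r z)"
      then have "ancestral_lineage r z = insert z (ancestral_lineage r y)"
        using lineage_step[of r z] by simp
      then show ?thesis using c by blast
    qed
  qed
next
  let ?E = "graph_edges r \<union> (graph_edges r)\<inverse>"
  assume "ancestral_lineage r i \<inter> ancestral_lineage r j \<noteq> {}"
  then obtain c where "(i, c) \<in> (graph_edges r)\<^sup>*" "(j, c) \<in> (graph_edges r)\<^sup>*"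
    by (auto simp: ancestral_lineage_def)
  then have "(i, c) \<in> ?E\<^sup>*" "(c, j) \<in> ?E\<^sup>*"
    by (meson in_rtrancl_UnI, metis in_rtrancl_UnI rtrancl_converseI)
  then show "same_component r i j" by (auto simp: same_component_def)
qed

text \<open>The highest common ancestor of two arbitrary vertices. Unlike the depth of the most recent
  common ancestor of \<open>0\<close> and \<open>n\<close>, this notion allows the starting vertices to move, which the
  recursion below needs.\<close>

definition meets_at :: "(int \<Rightarrow> nat) \<Rightarrow> int \<Rightarrow> int \<Rightarrow> int \<Rightarrow> bool" where
  "meets_at r i j d \<longleftrightarrow> d \<in> ancestral_lineage r i \<inter> ancestral_lineage r j \<and>
     (\<forall>e \<in> ancestral_lineage r i \<inter> ancestral_lineage r j. e \<le> d)"

lemma meets_at_unique: "meets_at r i j d \<Longrightarrow> meets_at r i j e \<Longrightarrow> d = e"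
  unfolding meets_at_def by (meson order_antisym)

lemma meets_at_commute: "meets_at r i j d = meets_at r j i d"
  by (auto simp: meets_at_def)

lemma meets_at_same: "meets_at r i i d \<longleftrightarrow> d = i"
  using lineage_self lineage_le unfolding meets_at_def by (metis Int_iff order_antisym)

lemma meets_at_le: "meets_at r i j d \<Longrightarrow> d \<le> i"
  by (auto simp: meets_at_def lineage_le)

text \<open>The higher of two vertices does not lie on the lineage of the lower one, so it may be replaced
  by its parent. Always moving the higher vertex means that each step is looked at before anything
  that depends on it.\<close>

lemma meets_at_step:
  assumes "j < i"
  shows "meets_at r i j d \<longleftrightarrow> meets_at r (i - int (r i)) j d"
proof -
  have "i \<notin> ancestral_lineage r j" using assms lineage_le by fastforce
  then have "ancestral_lineage r i \<inter> ancestral_lineage r j =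
      ancestral_lineage r (i - int (r i)) \<inter> ancestral_lineage r j"
    using lineage_step[of r i] by auto
  then show ?thesis by (simp add: meets_at_def)
qed

text \<open>Finitely many steps decide whether two lineages meet at \<^term>\<open>d\<close>. In the probabilistic part this provides
  both measurability and independence.\<close>

lemma meets_at_cong:
  assumes eq: "\<And>l. d < l \<Longrightarrow> l \<le> max i j \<Longrightarrow> r l = r' l"
  shows "meets_at r i j d \<longleftrightarrow> meets_at r' i j d"
proof -
  have "meets_at s' i j d" if "meets_at s i j d"
    and s: "\<And>l. d < l \<Longrightarrow> l \<le> max i j \<Longrightarrow> s l = s' l" for s s' :: "int \<Rightarrow> nat"
    unfolding meets_at_def
  proof
    show "d \<in> ancestral_lineage s' i \<inter> ancestral_lineage s' j"
      using that lineage_cong[of d s _ s'] by (auto simp: meets_at_def)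
    show "\<forall>e\<in>ancestral_lineage s' i \<inter> ancestral_lineage s' j. e \<le> d"
    proof (rule ballI, rule ccontr)
      fix e assume e: "e \<in> ancestral_lineage s' i \<inter> ancestral_lineage s' j" "\<not> e \<le> d"
      then have "e \<in> ancestral_lineage s i \<inter> ancestral_lineage s j"
        using s lineage_cong[of e s' _ s] by auto
      then show False using that(1) e(2) by (auto simp: meets_at_def)
    qed
  qed
  from this[of r r'] this[of r' r] show ?thesis using eq by auto
qed

lemma same_component_iff_meets:
  "same_component r i j \<longleftrightarrow> (\<exists>d. meets_at r i j d)"
proof
  assume "same_component r i j"
  then obtain c where c: "c \<in> ancestral_lineage r i \<inter> ancestral_lineage r j"
    using same_component_iff_common_ancestor by blast
  let ?A = "{e \<in> ancestral_lineage r i \<inter> ancestral_lineage r j. c \<le> e}"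
  have "?A \<subseteq> {c..i}" using lineage_le by auto
  then have fin: "finite ?A" by (rule finite_subset) simp
  have "meets_at r i j (Max ?A)"
    unfolding meets_at_def
  proof
    show "Max ?A \<in> ancestral_lineage r i \<inter> ancestral_lineage r j"
      using Max_in[OF fin] c by blast
    show "\<forall>e\<in>ancestral_lineage r i \<inter> ancestral_lineage r j. e \<le> Max ?A"
      using Max_ge[OF fin] c by (smt (verit) mem_Collect_eq)
  qed
  then show "\<exists>d. meets_at r i j d" ..
next
  assume "\<exists>d. meets_at r i j d"
  then show "same_component r i j"
    unfolding same_component_iff_common_ancestor meets_at_def by blast
qed

lemma mrca_depth_eq:
  assumes "meets_at r 0 (int n) d"
  shows "mrca_depth r n = ereal (- real_of_int d)"
proof -
  let ?S = "{j. j \<le> 0 \<and> j \<in> ancestral_lineage r 0 \<and> j \<in> ancestral_lineage r (int n)}"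
  have S: "?S = ancestral_lineage r 0 \<inter> ancestral_lineage r (int n)"
    using lineage_le by auto
  have d: "d \<in> ?S" "\<And>e. e \<in> ?S \<Longrightarrow> e \<le> d"
    using assms unfolding S meets_at_def by auto
  have "(GREATEST j. j \<in> ?S) = d" using d by (intro Greatest_equality)
  then show ?thesis using d(1) by (auto simp: mrca_depth_def mrca_def Let_def)
qed

lemma mrca_depth_not_connected:
  assumes "\<not> same_component r 0 (int n)"
  shows "mrca_depth r n = \<infinity>"
  using assms by (auto simp: mrca_depth_def mrca_def Let_def same_component_iff_common_ancestor)

section \<open>The renewal equation\<close>

lemma renewal_weight_0: "renewal_weight \<mu> 0 = 1"
proof -
  interpret product_prob_space "\<lambda>_. measure_pmf \<mu>" "UNIV :: nat set" by unfold_locales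
  have "{x. \<exists>j. (\<Sum>i<j. x i) = (0::nat)} = space (PiM UNIV (\<lambda>_::nat. measure_pmf \<mu>))"
    by (auto simp: space_PiM intro!: exI[of _ "0::nat"])
  then show ?thesis unfolding renewal_weight_def using P.prob_space by simp
qed

lemma renewal_weight_nonneg: "0 \<le> renewal_weight \<mu> n"
  by (simp add: renewal_weight_def)

text \<open>Condition on the first increment: the sequence space is the image of its product with one more
  copy of the law under prepending. A positive target cannot be hit by the empty sum.\<close>

lemma renewal_equation:
  assumes pos: "0 \<notin> set_pmf \<mu>" and n: "n > 0"
  shows "renewal_weight \<mu> n = (\<Sum>s=1..n. pmf \<mu> s * renewal_weight \<mu> (n - s))"
proof -
  interpret sequence_space "measure_pmf \<mu>" by unfold_locales
  define hit where "hit n = {x :: nat \<Rightarrow> nat. \<exists>j. (\<Sum>i<j. x i) = n}" for n :: nat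
  have hit_sets: "hit n \<in> sets S" for n
  proof -
    have "Measurable.pred S (\<lambda>x. \<exists>j. (\<Sum>i<j. x i) = n)" by measurable
    then show ?thesis by (simp add: hit_def pred_def space_PiM)
  qed
  note hit_sets[measurable]
  have q: "renewal_weight \<mu> k = measure S (hit k)" for k
    by (simp add: renewal_weight_def hit_def)
  have split: "case_nat s x \<in> hit n \<longleftrightarrow> s \<le> n \<and> x \<in> hit (n - s)" for s x
  proof
    assume "case_nat s x \<in> hit n"
    then obtain j where j: "(\<Sum>i<j. case_nat s x i) = n" by (auto simp: hit_def)
    with n obtain j' where "j = Suc j'" by (cases j) auto
    with j have "s + (\<Sum>i<j'. x i) = n" by (simp add: sum.lessThan_Suc_shift del: sum.lessThan_Suc)
    then show "s \<le> n \<and> x \<in> hit (n - s)" by (auto simp: hit_def)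
  next
    assume s: "s \<le> n \<and> x \<in> hit (n - s)"
    then obtain j where "(\<Sum>i<j. x i) = n - s" by (auto simp: hit_def)
    then have "(\<Sum>i<Suc j. case_nat s x i) = n"
      using s by (simp add: sum.lessThan_Suc_shift del: sum.lessThan_Suc)
    then show "case_nat s x \<in> hit n" unfolding hit_def by blast
  qed
  have "emeasure S (hit n) = emeasure (distr (measure_pmf \<mu> \<Otimes>\<^sub>M S) S (\<lambda>(s, x). case_nat s x)) (hit n)"
    by (simp only: PiM_iter)
  also have "\<dots> = emeasure (measure_pmf \<mu> \<Otimes>\<^sub>M S)
      ((\<lambda>(s, x). case_nat s x) -` hit n \<inter> space (measure_pmf \<mu> \<Otimes>\<^sub>M S))"
    by (rule emeasure_distr) measurable
  also have "\<dots> = (\<integral>\<^sup>+s. emeasure S (Pair s -` ((\<lambda>(s, x). case_nat s x) -` hit n \<inter> space (measure_pmf \<mu> \<Otimes>\<^sub>M S))) \<partial>measure_pmf \<mu>)"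
    by (rule P.emeasure_pair_measure_alt) measurable
  also have "\<dots> = (\<integral>\<^sup>+s. ennreal (if s \<le> n then renewal_weight \<mu> (n - s) else 0) \<partial>measure_pmf \<mu>)"
  proof (rule nn_integral_cong)
    fix s
    have "Pair s -` ((\<lambda>(s, x). case_nat s x) -` hit n \<inter> space (measure_pmf \<mu> \<Otimes>\<^sub>M S)) =
      (if s \<le> n then hit (n - s) else {})"
      by (auto simp: split space_pair_measure space_PiM)
    then show "emeasure S (Pair s -` ((\<lambda>(s, x). case_nat s x) -` hit n \<inter> space (measure_pmf \<mu> \<Otimes>\<^sub>M S)))
      = ennreal (if s \<le> n then renewal_weight \<mu> (n - s) else 0)"
      by (simp add: q P.emeasure_eq_measure)
  qed
  also have "\<dots> = ennreal (\<integral>s. (if s \<le> n then renewal_weight \<mu> (n - s) else 0) \<partial>measure_pmf \<mu>)"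
    by (intro nn_integral_eq_integral measure_pmf.integrable_const_bound[where B=1] AE_I2)
      (auto simp: renewal_weight_nonneg q)
  also have "(\<integral>s. (if s \<le> n then renewal_weight \<mu> (n - s) else 0) \<partial>measure_pmf \<mu>) =
      (\<Sum>s=1..n. pmf \<mu> s * renewal_weight \<mu> (n - s))"
    using pos by (subst integral_measure_pmf_real[of "{1..n}"])
      (auto simp: mult.commute Suc_le_eq intro: gr0I split: if_splits intro!: sum.cong)
  finally show ?thesis
    by (simp add: q P.emeasure_eq_measure sum_nonneg)
qed

section \<open>Meeting probabilities in the random graph\<close>

locale renewal_graph = prob_space M for M :: "'a measure" +
  fixes \<mu> :: "nat pmf" and R :: "int \<Rightarrow> 'a \<Rightarrow> nat"
  assumes steps_positive: "0 \<notin> set_pmf \<mu>"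
    and steps_indep: "indep_vars (\<lambda>_. count_space UNIV) R UNIV"
    and steps_law: "\<And>i. distr M (count_space UNIV) (R i) = measure_pmf \<mu>"
begin

lemma steps_measurable [measurable]: "R i \<in> measurable M (count_space UNIV)"
  using steps_indep by (simp add: indep_vars_def)

lemma prob_step: "prob {\<omega> \<in> space M. R i \<omega> = s} = pmf \<mu> s"
proof -
  have "pmf \<mu> s = measure (distr M (count_space UNIV) (R i)) {s}"
    unfolding steps_law by (simp add: measure_pmf_single)
  also have "\<dots> = prob (R i -` {s} \<inter> space M)" by (rule measure_distr) simp_all
  also have "R i -` {s} \<inter> space M = {\<omega> \<in> space M. R i \<omega> = s}" by auto
  finally show ?thesis by simp
qed

text \<open>An event that depends on finitely many steps is a preimage under a random variable with
  countable discrete range, so it is measurable, and independent of every step not involved.\<close>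

lemma
  assumes fin: "finite I" and dep: "\<And>r r'. (\<And>l. l \<in> I \<Longrightarrow> r l = r' l) \<Longrightarrow> P r = P r'"
  shows finitely_determined_event: "{\<omega> \<in> space M. P (\<lambda>l. R l \<omega>)} \<in> events"
    and finitely_determined_indep: "i \<notin> I \<Longrightarrow>
      prob {\<omega> \<in> space M. R i \<omega> = s \<and> P (\<lambda>l. R l \<omega>)} =
      pmf \<mu> s * prob {\<omega> \<in> space M. P (\<lambda>l. R l \<omega>)}"
proof -
  let ?N = "\<lambda>J. PiM J (\<lambda>_. count_space UNIV) :: (int \<Rightarrow> nat) measure"
  let ?X = "\<lambda>J \<omega>. restrict (\<lambda>l. R l \<omega>) J"
  let ?A = "{f \<in> PiE I (\<lambda>_. UNIV). P f}"
  have N: "?N J = count_space (PiE J (\<lambda>_. UNIV))" if "finite J" for J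
    using that by (intro count_space_PiM_finite) auto
  have X: "?X I \<in> measurable M (?N I)" by measurable
  have A: "?A \<in> sets (?N I)" by (simp add: N[OF fin])
  have eq: "?X I -` ?A \<inter> space M = {\<omega> \<in> space M. P (\<lambda>l. R l \<omega>)}"
  proof -
    have "P (?X I \<omega>) = P (\<lambda>l. R l \<omega>)" for \<omega> by (rule dep) simp
    then show ?thesis by auto
  qed
  show "{\<omega> \<in> space M. P (\<lambda>l. R l \<omega>)} \<in> events"
    using measurable_sets[OF X A] unfolding eq .
  assume i: "i \<notin> I"
  let ?B = "{f \<in> PiE {i} (\<lambda>_. UNIV). f i = s}"
  have B: "?B \<in> sets (?N {i})" by (simp add: N)
  have "indep_var (?N {i}) (?X {i}) (?N I) (?X I)"
    using i by (intro indep_var_restrict[OF steps_indep]) auto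
  from indep_varD[OF this B A]
  have "prob ((\<lambda>\<omega>. (?X {i} \<omega>, ?X I \<omega>)) -` (?B \<times> ?A) \<inter> space M) =
    prob (?X {i} -` ?B \<inter> space M) * prob (?X I -` ?A \<inter> space M)" .
  moreover have "?X {i} -` ?B \<inter> space M = {\<omega> \<in> space M. R i \<omega> = s}" by auto
  moreover have "(\<lambda>\<omega>. (?X {i} \<omega>, ?X I \<omega>)) -` (?B \<times> ?A) \<inter> space M =
    {\<omega> \<in> space M. R i \<omega> = s \<and> P (\<lambda>l. R l \<omega>)}"
    using eq by auto
  ultimately show "prob {\<omega> \<in> space M. R i \<omega> = s \<and> P (\<lambda>l. R l \<omega>)} =
      pmf \<mu> s * prob {\<omega> \<in> space M. P (\<lambda>l. R l \<omega>)}"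
    by (simp only: eq prob_step)
qed

definition meet_event :: "int \<Rightarrow> int \<Rightarrow> int \<Rightarrow> 'a set" where
  "meet_event i j d = {\<omega> \<in> space M. meets_at (\<lambda>l. R l \<omega>) i j d}"

lemma meet_event_measurable [measurable]: "meet_event i j d \<in> events"
  unfolding meet_event_def
  by (rule finitely_determined_event[of "{d<..max i j}"]) (auto intro!: meets_at_cong)

text \<open>Condition on the step of the higher vertex \<^term>\<open>i\<close>. What follows is decided by vertices
  below \<^term>\<open>i\<close>, hence independent of that step. Any bound \<^term>\<open>m\<close> below the meeting point
  truncates the sum, since a longer step jumps past that point.\<close>

lemma meet_prob_step:
  assumes "j < i" "m \<le> d"
  shows "prob (meet_event i j d) =
    (\<Sum>s=1..nat (i - m). pmf \<mu> s * prob (meet_event (i - int s) j d))"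
proof -
  let ?N = "nat (i - m)"
  let ?E = "\<lambda>s. {\<omega> \<in> space M. R i \<omega> = s \<and> meets_at (\<lambda>l. R l \<omega>) (i - int s) j d}"
  have E: "?E s \<in> events" for s
  proof -
    have "meet_event (i - int s) j d \<inter> {\<omega> \<in> space M. R i \<omega> = s} \<in> events" by measurable
    also have "meet_event (i - int s) j d \<inter> {\<omega> \<in> space M. R i \<omega> = s} = ?E s"
      by (auto simp: meet_event_def)
    finally show ?thesis .
  qed
  have dep: "meets_at r (i - int s) j d = meets_at r' (i - int s) j d"
    if "\<And>l. l \<in> {d<..i - 1} \<Longrightarrow> r l = r' l" "s \<ge> 1" for r r' s
    using that assms by (intro meets_at_cong) auto
  have "prob {\<omega> \<in> space M. R i \<omega> = 0} = 0"
    using steps_positive by (simp add: prob_step pmf_eq_0_set_pmf)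
  then have "AE \<omega> in M. R i \<omega> \<noteq> 0"
    by (subst AE_iff_measurable[OF _ refl]) (auto simp: emeasure_eq_measure)
  then have "prob (meet_event i j d) = prob (\<Union>s\<in>{1..?N}. ?E s)"
  proof (intro finite_measure_eq_AE)
    show "AE \<omega> in M. \<omega> \<in> meet_event i j d \<longleftrightarrow> \<omega> \<in> (\<Union>s\<in>{1..?N}. ?E s)"
      if "AE \<omega> in M. R i \<omega> \<noteq> 0"
      using that
    proof eventually_elim
      case (elim \<omega>)
      have "R i \<omega> \<in> {1..?N}" if "meets_at (\<lambda>l. R l \<omega>) (i - int (R i \<omega>)) j d"
        using meets_at_le[OF that] elim assms by auto
      then show ?case
        using meets_at_step[OF assms(1), of "\<lambda>l. R l \<omega>" d] by (auto simp: meet_event_def)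
    qed
  qed (use E in auto)
  also have "\<dots> = (\<Sum>s=1..?N. prob (?E s))"
  proof (rule finite_measure_finite_Union)
    show "?E ` {1..?N} \<subseteq> events" using E by blast
  qed (auto simp: disjoint_family_on_def)
  also have "\<dots> = (\<Sum>s=1..?N. pmf \<mu> s * prob (meet_event (i - int s) j d))"
    unfolding meet_event_def
    by (intro sum.cong refl finitely_determined_indep[of "{d<..i - 1}"] dep) auto
  finally show ?thesis .
qed

lemma meet_event_commute: "meet_event i j d = meet_event j i d"
  by (simp add: meet_event_def meets_at_commute)

lemma meet_event_same: "meet_event i i d = (if d = i then space M else {})"
  by (auto simp: meet_event_def meets_at_same)

lemma meet_event_empty: "d > i \<Longrightarrow> meet_event i j d = {}"
  using meets_at_le by (fastforce simp: meet_event_def)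

abbreviation q :: "nat \<Rightarrow> real" where "q \<equiv> renewal_weight \<mu>"

text \<open>The left side is the probability that two independent renewal walks, run downwards from
  \<open>m + a\<close> and \<open>m + b\<close>, both hit \<^term>\<open>m\<close>. Before they meet, two lineages behave like
  independent walks; so cut the walks at their first common point \<open>m + c\<close>, from where each
  still has to descend by \<^term>\<open>c\<close>. The proof by induction rests on the fact that both sides
  satisfy the same recursion, in which the higher walk moves first.\<close>

lemma renewal_pair_decomposition:
  assumes "a \<le> N" "b \<le> N"
  shows "q a * q b = (\<Sum>c\<le>N. prob (meet_event (m + int a) (m + int b) (m + int c)) * (q c)\<^sup>2)"
  using assms
proof (induction "a + b" arbitrary: a b rule: less_induct)
  case less
  have step: "q a * q b = (\<Sum>c\<le>N. prob (meet_event (m + int a) (m + int b) (m + int c)) * (q c)\<^sup>2)"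
    if ba: "b < a" and "a \<le> N"
    and IH: "\<And>s. 1 \<le> s \<Longrightarrow> s \<le> a \<Longrightarrow> q (a - s) * q b =
      (\<Sum>c\<le>N. prob (meet_event (m + int (a - s)) (m + int b) (m + int c)) * (q c)\<^sup>2)" for a b
  proof -
    have "q a * q b = (\<Sum>s=1..a. pmf \<mu> s * (q (a - s) * q b))"
      using ba by (subst renewal_equation[OF steps_positive]) (auto simp: sum_distrib_right mult.assoc)
    also have "\<dots> = (\<Sum>s=1..a. \<Sum>c\<le>N. pmf \<mu> s *
        (prob (meet_event (m + int (a - s)) (m + int b) (m + int c)) * (q c)\<^sup>2))"
      by (intro sum.cong refl) (simp only: IH atLeastAtMost_iff sum_distrib_left)
    also have "\<dots> = (\<Sum>c\<le>N. \<Sum>s=1..a. pmf \<mu> s *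
        (prob (meet_event (m + int (a - s)) (m + int b) (m + int c)) * (q c)\<^sup>2))"
      by (rule sum.swap)
    also have "\<dots> = (\<Sum>c\<le>N. prob (meet_event (m + int a) (m + int b) (m + int c)) * (q c)\<^sup>2)"
    proof (intro sum.cong refl)
      fix c
      have "prob (meet_event (m + int a) (m + int b) (m + int c)) =
        (\<Sum>s=1..a. pmf \<mu> s * prob (meet_event (m + int a - int s) (m + int b) (m + int c)))"
        using ba by (subst meet_prob_step[where m=m]) auto
      also have "\<dots> = (\<Sum>s=1..a. pmf \<mu> s * prob (meet_event (m + int (a - s)) (m + int b) (m + int c)))"
        by (intro sum.cong refl) (simp add: of_nat_diff add_diff_eq)
      finally show "(\<Sum>s=1..a. pmf \<mu> s *
          (prob (meet_event (m + int (a - s)) (m + int b) (m + int c)) * (q c)\<^sup>2)) =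
        prob (meet_event (m + int a) (m + int b) (m + int c)) * (q c)\<^sup>2"
        by (simp add: sum_distrib_right mult.assoc)
    qed
    finally show ?thesis .
  qed
  consider "b < a" | "a < b" | "a = b" by linarith
  then show ?case
  proof cases
    case 1
    then show ?thesis
    proof (rule step)
      show "q (a - s) * q b =
        (\<Sum>c\<le>N. prob (meet_event (m + int (a - s)) (m + int b) (m + int c)) * (q c)\<^sup>2)"
        if "1 \<le> s" "s \<le> a" for s
        using that less.prems by (intro less.hyps) auto
    qed (use less.prems in simp)
  next
    case 2
    have "q b * q a = (\<Sum>c\<le>N. prob (meet_event (m + int b) (m + int a) (m + int c)) * (q c)\<^sup>2)"
    proof (rule step[OF 2])
      fix s assume s: "1 \<le> s" "s \<le> b"
      have "q a * q (b - s) = (\<Sum>c\<le>N. prob (meet_event (m + int a) (m + int (b - s)) (m + int c)) * (q c)\<^sup>2)"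
        using s less.prems by (intro less.hyps) auto
      then show "q (b - s) * q a = (\<Sum>c\<le>N. prob (meet_event (m + int (b - s)) (m + int a) (m + int c)) * (q c)\<^sup>2)"
        by (subst mult.commute, subst meet_event_commute)
    qed (use less.prems in simp)
    then show ?thesis by (subst mult.commute, subst meet_event_commute)
  next
    case 3
    have "(\<Sum>c\<le>N. prob (meet_event (m + int a) (m + int b) (m + int c)) * (q c)\<^sup>2) =
      (\<Sum>c\<le>N. if c = a then (q c)\<^sup>2 else 0)"
      using 3 by (intro sum.cong refl) (auto simp: meet_event_same prob_space)
    then show ?thesis using 3 less.prems by (simp add: power2_eq_square)
  qed
qed

definition depth_prob :: "nat \<Rightarrow> nat \<Rightarrow> real" where
  "depth_prob n e = prob (meet_event 0 (int n) (- int e))"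

text \<open>The decomposition for walks from \<open>0\<close> and \<open>n\<close> down to \<open>- k\<close>, written in terms of depth.\<close>

lemma renewal_product_convolution:
  "q k * q (n + k) = (\<Sum>e\<le>k. depth_prob n e * (q (k - e))\<^sup>2)"
proof -
  let ?g = "\<lambda>c. prob (meet_event 0 (int n) (int c - int k)) * (q c)\<^sup>2"
  have "q k * q (n + k) = (\<Sum>c\<le>n+k. ?g c)"
    using renewal_pair_decomposition[of k "n + k" "n + k" "- int k"] by simp
  also have "\<dots> = (\<Sum>c\<le>k. ?g c)"
    by (intro sum.mono_neutral_right) (auto simp: meet_event_empty)
  also have "\<dots> = (\<Sum>e\<le>k. ?g (k - e))"
    by (rule sum.reindex_bij_witness[where i="\<lambda>c. k - c" and j="\<lambda>c. k - c"]) auto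
  also have "\<dots> = (\<Sum>e\<le>k. depth_prob n e * (q (k - e))\<^sup>2)"
    by (intro sum.cong refl) (simp add: depth_prob_def of_nat_diff)
  finally show ?thesis .
qed

abbreviation connected_event :: "nat \<Rightarrow> 'a set" where
  "connected_event n \<equiv> {\<omega> \<in> space M. same_component (\<lambda>i. R i \<omega>) 0 (int n)}"

abbreviation scaled_depth :: "nat \<Rightarrow> 'a \<Rightarrow> real" where
  "scaled_depth n \<omega> \<equiv> real_of_ereal (mrca_depth (\<lambda>i. R i \<omega>) n) / real n"

lemma connected_event_eq: "connected_event n = (\<Union>e. meet_event 0 (int n) (- int e))"
proof -
  have "\<exists>e. d = - int e" if "meets_at (\<lambda>i. R i \<omega>) 0 (int n) d" for \<omega> d
    using meets_at_le[OF that] by (intro exI[of _ "nat (- d)"]) simp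
  then show ?thesis by (auto simp: same_component_iff_meets meet_event_def) metis
qed

lemma connected_event_measurable: "connected_event n \<in> events"
  unfolding connected_event_eq by (intro sets.countable_UN) auto

lemma disjoint_depths: "disjoint_family (\<lambda>e. meet_event 0 (int n) (- int e))"
  by (auto simp: disjoint_family_on_def meet_event_def dest: meets_at_unique)

lemma depth_prob_sums: "depth_prob n sums prob (connected_event n)"
  unfolding connected_event_eq depth_prob_def
  by (intro finite_measure_UNION disjoint_depths) auto

lemma scaled_depth_eq: "\<omega> \<in> meet_event 0 (int n) (- int e) \<Longrightarrow> scaled_depth n \<omega> = real e / real n"
  by (auto simp: meet_event_def mrca_depth_eq)

text \<open>Off the event that \<open>0\<close> and \<open>n\<close> are connected, the depth is infinite and is read as the
  real number \<open>0\<close>. This has no influence on the conditional law, but measurability concerns the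
  whole space.\<close>

lemma scaled_depth_measurable: "scaled_depth n \<in> borel_measurable M"
  unfolding borel_measurable_iff_le
proof
  fix a
  have "{\<omega> \<in> space M. scaled_depth n \<omega> \<le> a} =
      (\<Union>e\<in>{e. real e / real n \<le> a}. meet_event 0 (int n) (- int e)) \<union>
      (if 0 \<le> a then space M - connected_event n else {})" (is "?L = ?R")
  proof (rule set_eqI)
    fix \<omega>
    show "\<omega> \<in> ?L \<longleftrightarrow> \<omega> \<in> ?R"
    proof (cases "\<omega> \<in> connected_event n")
      case True
      then obtain e where e: "\<omega> \<in> meet_event 0 (int n) (- int e)" unfolding connected_event_eq by blast
      then have "\<omega> \<in> meet_event 0 (int n) (- int e') \<longleftrightarrow> e' = e" for e'
        using disjoint_depths[of n] by (auto simp: disjoint_family_on_def)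
      then show ?thesis using True scaled_depth_eq[OF e] by auto
    next
      case False
      then have "\<omega> \<notin> meet_event 0 (int n) (- int e)" for e unfolding connected_event_eq by blast
      then show ?thesis using False by (auto simp: mrca_depth_not_connected)
    qed
  qed
  also have "\<dots> \<in> events"
    using connected_event_measurable by (auto intro!: sets.Un sets.countable_UN')
  finally show "{\<omega> \<in> space M. scaled_depth n \<omega> \<le> a} \<in> events" .
qed

lemma cdf_scaled_depth:
  assumes n: "n > 0" and pos: "(\<Sum>e. depth_prob n e) > 0"
  shows "cdf (distr (uniform_measure M (connected_event n)) borel (scaled_depth n)) x =
    (if x < 0 then 0 else (\<Sum>e\<le>nat \<lfloor>x * real n\<rfloor>. depth_prob n e) / (\<Sum>e. depth_prob n e))"
proof -
  have U: "prob (connected_event n) = (\<Sum>e. depth_prob n e)"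
    using depth_prob_sums[of n] by (simp add: sums_iff)
  let ?V = "scaled_depth n -` {..x} \<inter> space M"
  have V: "?V \<in> events" by (rule measurable_sets[OF scaled_depth_measurable]) simp
  have "cdf (distr (uniform_measure M (connected_event n)) borel (scaled_depth n)) x =
      measure (uniform_measure M (connected_event n)) ?V"
    unfolding cdf_def
    by (subst measure_distr) (use scaled_depth_measurable in \<open>simp_all cong: measurable_cong_sets\<close>)
  also have "\<dots> = prob (connected_event n \<inter> ?V) / prob (connected_event n)"
    using V pos connected_event_measurable[of n]
    by (intro measure_uniform_measure) (auto simp: emeasure_eq_measure U)
  also have "prob (connected_event n \<inter> ?V) =
      (if x < 0 then 0 else (\<Sum>e\<le>nat \<lfloor>x * real n\<rfloor>. depth_prob n e))"
  proof -
    have iff: "real e / real n \<le> x \<longleftrightarrow> 0 \<le> x \<and> e \<le> nat \<lfloor>x * real n\<rfloor>" for e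
    proof (cases "x < 0")
      case True
      have "0 \<le> real e / real n" by simp
      then show ?thesis using True by linarith
    next
      case False
      then have "real e / real n \<le> x \<longleftrightarrow> real e \<le> x * real n" using n by (simp add: pos_divide_le_eq)
      also have "\<dots> \<longleftrightarrow> e \<le> nat \<lfloor>x * real n\<rfloor>" using False by (simp add: le_nat_iff le_floor_iff)
      finally show ?thesis using False by simp
    qed
    have "connected_event n \<inter> ?V =
        (if x < 0 then {} else (\<Union>e\<in>{..nat \<lfloor>x * real n\<rfloor>}. meet_event 0 (int n) (- int e)))"
      (is "?L = ?R")
    proof (rule set_eqI)
      fix \<omega>
      show "\<omega> \<in> ?L \<longleftrightarrow> \<omega> \<in> ?R"
      proof (cases "\<omega> \<in> connected_event n")
        case True
        then obtain e where e: "\<omega> \<in> meet_event 0 (int n) (- int e)" unfolding connected_event_eq by blast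
        then have "\<omega> \<in> meet_event 0 (int n) (- int e') \<longleftrightarrow> e' = e" for e'
          using disjoint_depths[of n] by (auto simp: disjoint_family_on_def)
        then show ?thesis using True scaled_depth_eq[OF e] iff[of e] by auto
      next
        case False
        then have "\<omega> \<notin> meet_event 0 (int n) (- int e)" for e unfolding connected_event_eq by blast
        then show ?thesis using False by auto
      qed
    qed
    moreover have "prob (\<Union>e\<in>{..m}. meet_event 0 (int n) (- int e)) = (\<Sum>e\<le>m. depth_prob n e)" for m
      unfolding depth_prob_def
      by (intro finite_measure_finite_Union disjoint_family_on_mono[OF _ disjoint_depths]) auto
    ultimately show ?thesis by simp
  qed
  finally show ?thesis by (simp add: U)
qed

end

section \<open>Monotone regularly varying sequences\<close>

lemma positive_rational_nat_ratio:
  fixes v :: real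
  assumes "v \<in> \<rat>" "0 < v"
  obtains a b :: nat where "a > 0" "b > 0" "v = real b / real a"
proof -
  obtain b a :: nat where ab: "a \<noteq> 0" "\<bar>v\<bar> = real b / real a"
    using Rats_abs_nat_div_natE[OF assms(1)] by metis
  with assms(2) have "v = real b / real a" "b \<noteq> 0" by (auto intro: Nat.gr0I)
  with ab that[of a b] show ?thesis by simp
qed

lemma div_ratio_limit:
  fixes a :: nat
  assumes "a > 0"
  shows "(\<lambda>n. real (n div a) / real n) \<longlonglongrightarrow> 1 / real a"
proof (rule tendsto_sandwich)
  show "eventually (\<lambda>n. 1 / real a - 1 / real n \<le> real (n div a) / real n) at_top"
  proof (rule eventually_sequentiallyI[of 1])
    fix n :: nat assume n: "1 \<le> n"
    have "n \<le> a * Suc (n div a)" using assms dividend_less_times_div[of a n] by simp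
    then have "real n \<le> real a * real (Suc (n div a))" by (metis of_nat_le_iff of_nat_mult)
    then have "real n / real a - 1 \<le> real (n div a)"
      using assms by (simp add: field_simps)
    then have "(real n / real a - 1) / real n \<le> real (n div a) / real n"
      by (rule divide_right_mono) simp
    then show "1 / real a - 1 / real n \<le> real (n div a) / real n"
      using n by (simp add: diff_divide_distrib)
  qed
  show "eventually (\<lambda>n. real (n div a) / real n \<le> 1 / real a) at_top"
  proof (rule eventually_sequentiallyI[of 1])
    fix n :: nat assume n: "1 \<le> n"
    have "real (n div a) \<le> real n / real a" by (rule of_nat_div_le_of_nat)
    then show "real (n div a) / real n \<le> 1 / real a"
      using assms n by (simp add: field_simps)
  qed
  have "(\<lambda>n. 1 / real a - 1 / real n) \<longlonglongrightarrow> 1 / real a - 0"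
    by (intro tendsto_intros lim_1_over_n)
  then show "(\<lambda>n. 1 / real a - 1 / real n) \<longlonglongrightarrow> 1 / real a" by simp
qed simp

text \<open>Convergence along \<open>c * n\<close> for every fixed integer \<open>c\<close> gives convergence of
  \<open>H (b * m) / H (a * m)\<close>. If \<open>b / a\<close> is slightly above \<open>u\<close> and \<open>m\<close> is
  \<open>n / a\<close> rounded down, then eventually \<open>a * m \<le> n\<close> and \<open>k n \<le> b * m\<close>, so that quotient
  bounds \<open>H (k n) / H n\<close> from above. For the lower bound take \<open>b / a\<close> slightly below \<open>u\<close> and
  round up. Monotonicity does here the work of a uniform convergence theorem for slowly varying
  functions.\<close>

lemma monotone_ratio_limit:
  fixes H :: "nat \<Rightarrow> real" and k :: "nat \<Rightarrow> nat"
  assumes mono: "mono H" and pos: "\<And>n. H n > 0" and al: "\<alpha> > 0"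
    and reg: "\<And>c. c > 0 \<Longrightarrow> (\<lambda>n. H (c * n) / H n) \<longlonglongrightarrow> real c powr \<alpha>"
    and k: "(\<lambda>n. real (k n) / real n) \<longlonglongrightarrow> u" and u: "u > 0"
  shows "(\<lambda>n. H (k n) / H n) \<longlonglongrightarrow> u powr \<alpha>"
proof -
  have rat: "(\<lambda>m. H (b * m) / H (a * m)) \<longlonglongrightarrow> (real b / real a) powr \<alpha>" if "a > 0" "b > 0" for a b :: nat
  proof -
    have "(\<lambda>m. (H (b * m) / H m) / (H (a * m) / H m)) \<longlonglongrightarrow> real b powr \<alpha> / real a powr \<alpha>"
      using that by (intro tendsto_divide reg) auto
    moreover have "(\<lambda>m. (H (b * m) / H m) / (H (a * m) / H m)) = (\<lambda>m. H (b * m) / H (a * m))"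
      using pos by (auto simp: fun_eq_iff less_imp_neq[symmetric])
    moreover have "real b powr \<alpha> / real a powr \<alpha> = (real b / real a) powr \<alpha>"
      by (simp add: powr_divide)
    ultimately show ?thesis by metis
  qed
  have div_top: "filterlim (\<lambda>n. n div a) at_top at_top" if "a > 0" for a :: nat
    unfolding filterlim_at_top
    using that by (auto simp: eventually_at_top_linorder less_eq_div_iff_mult_less_eq intro!: exI[of _ "_ * a"])
  have cont: "(\<lambda>v. v powr \<alpha>) \<midarrow>u\<rightarrow> u powr \<alpha>"
    using u by (intro tendsto_intros) auto
  show ?thesis
  proof (rule order_tendstoI)
    fix y assume y: "y < u powr \<alpha>"
    have "\<exists>v\<in>\<rat>. 0 < v \<and> v < u \<and> y < v powr \<alpha>"
    proof -
      have "eventually (\<lambda>v. y < v powr \<alpha>) (at_left u)"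
        using order_tendstoD(1)[OF filterlim_at_split[THEN iffD1, OF cont, THEN conjunct1] y] .
      then obtain w where w: "w < u" "\<And>v. w < v \<Longrightarrow> v < u \<Longrightarrow> y < v powr \<alpha>"
        unfolding eventually_at_left_field by blast
      obtain v where "v \<in> \<rat>" "max w 0 < v" "v < u" using Rats_dense_in_real[of "max w 0" u] w u by auto
      then show ?thesis using w by auto
    qed
    then obtain v where v: "v \<in> \<rat>" "0 < v" "v < u" "y < v powr \<alpha>" by blast
    then obtain b a :: nat where ab: "a > 0" "b > 0" "v = real b / real a"
      using positive_rational_nat_ratio by metis
    let ?m = "\<lambda>n. Suc (n div a)"
    have m_top: "filterlim ?m at_top at_top"
      by (rule filterlim_compose[OF filterlim_Suc div_top[OF ab(1)]])
    have ev1: "eventually (\<lambda>n. y < H (b * ?m n) / H (a * ?m n)) at_top"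
      using order_tendstoD(1)[OF filterlim_compose[OF rat[OF ab(1,2)] m_top]] v ab by simp
    have "(\<lambda>n. real b * (real (n div a) / real n + 1 / real n)) \<longlonglongrightarrow> real b * (1 / real a + 0)"
      by (intro tendsto_intros div_ratio_limit lim_1_over_n ab)
    then have "(\<lambda>n. real (b * ?m n) / real n) \<longlonglongrightarrow> v"
      by (simp add: ab(3) distrib_left add_divide_distrib add.commute)
    then have "(\<lambda>n. real (k n) / real n - real (b * ?m n) / real n) \<longlonglongrightarrow> u - v"
      by (intro tendsto_diff k)
    then have ev2: "eventually (\<lambda>n. 0 < real (k n) / real n - real (b * ?m n) / real n) at_top"
      by (rule order_tendstoD(1)) (use v in simp)
    show "eventually (\<lambda>n. y < H (k n) / H n) at_top"
      using ev1 ev2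
    proof eventually_elim
      case (elim n)
      have "b * ?m n \<le> k n" using elim(2)
        by (simp add: divide_less_cancel diff_divide_distrib[symmetric] zero_less_divide_iff del: of_nat_mult mult_Suc_right)
      moreover have "n \<le> a * ?m n" using ab(1) dividend_less_times_div[of a n] by simp
      ultimately have "H (b * ?m n) / H (a * ?m n) \<le> H (k n) / H n"
        using mono pos by (intro frac_le) (auto simp: mono_def less_imp_le)
      then show ?case using elim(1) by linarith
    qed
  next
    fix y assume y: "u powr \<alpha> < y"
    have "\<exists>v\<in>\<rat>. u < v \<and> v powr \<alpha> < y"
    proof -
      have "eventually (\<lambda>v. v powr \<alpha> < y) (at_right u)"
        using order_tendstoD(2)[OF filterlim_at_split[THEN iffD1, OF cont, THEN conjunct2] y] .
      then obtain w where w: "w > u" "\<And>v. u < v \<Longrightarrow> v < w \<Longrightarrow> v powr \<alpha> < y"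
        unfolding eventually_at_right_field by blast
      then show ?thesis using Rats_dense_in_real[of u w] by auto
    qed
    then obtain v where v: "v \<in> \<rat>" "0 < v" "u < v" "v powr \<alpha> < y" using u by force
    then obtain b a :: nat where ab: "a > 0" "b > 0" "v = real b / real a"
      using positive_rational_nat_ratio by metis
    let ?m = "\<lambda>n. n div a"
    have ev1: "eventually (\<lambda>n. H (b * ?m n) / H (a * ?m n) < y) at_top"
      using order_tendstoD(2)[OF filterlim_compose[OF rat[OF ab(1,2)] div_top[OF ab(1)]]] v ab by simp
    have "(\<lambda>n. real b * (real (n div a) / real n)) \<longlonglongrightarrow> real b * (1 / real a)"
      by (intro tendsto_intros div_ratio_limit ab)
    then have "(\<lambda>n. real (b * ?m n) / real n) \<longlonglongrightarrow> v"
      by (simp add: ab(3))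
    then have "(\<lambda>n. real (b * ?m n) / real n - real (k n) / real n) \<longlonglongrightarrow> v - u"
      by (intro tendsto_diff k)
    then have ev2: "eventually (\<lambda>n. 0 < real (b * ?m n) / real n - real (k n) / real n) at_top"
      by (rule order_tendstoD(1)) (use v in simp)
    show "eventually (\<lambda>n. H (k n) / H n < y) at_top"
      using ev1 ev2
    proof eventually_elim
      case (elim n)
      have "k n \<le> b * ?m n" using elim(2)
        by (simp add: divide_less_cancel diff_divide_distrib[symmetric] zero_less_divide_iff del: of_nat_mult)
      moreover have "a * ?m n \<le> n" by simp
      ultimately have "H (k n) / H n \<le> H (b * ?m n) / H (a * ?m n)"
        using mono pos by (intro frac_le) (auto simp: mono_def less_imp_le)
      then show ?case using elim(1) by linarith
    qed
  qed
qed

text \<open>Potter's bound for \<open>k \<ge> n\<close>. Beyond a threshold, doubling the argument multiplies \<^term>\<open>H\<close> by at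
  most \<open>2 powr \<beta>\<close>; iterate. The finitely many values below the threshold are absorbed into the
  constant, which is where \<open>H \<ge> 1\<close> helps.\<close>

lemma potter_upper:
  fixes H :: "nat \<Rightarrow> real"
  assumes mono: "mono H" and H1: "\<And>n. H n \<ge> 1" and be: "\<beta> > \<alpha>" "\<beta> > 0"
    and reg: "(\<lambda>n. H (2 * n) / H n) \<longlonglongrightarrow> 2 powr \<alpha>"
  shows "\<exists>A>0. \<forall>n k. 1 \<le> n \<longrightarrow> n \<le> k \<longrightarrow> H k / H n \<le> A * (real k / real n) powr \<beta>"
proof -
  have "2 powr \<alpha> < 2 powr \<beta>" using be by simp
  then have "eventually (\<lambda>n. H (2 * n) / H n < 2 powr \<beta>) at_top"
    by (rule order_tendstoD(2)[OF reg])
  then obtain m where m0: "\<And>n. n \<ge> m \<Longrightarrow> H (2 * n) / H n < 2 powr \<beta>"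
    unfolding eventually_at_top_linorder by blast
  define M where "M = max m 1"
  have pos: "H n > 0" for n using H1[of n] by linarith
  have M: "H (2 * n) \<le> 2 powr \<beta> * H n" if "n \<ge> M" for n
    using m0[of n] that pos[of n] by (simp add: M_def field_simps)
  have mon: "H i \<le> H j" if "i \<le> j" for i j using mono that by (simp add: mono_def)
  have big: "H k \<le> 2 powr \<beta> * (real k / real n) powr \<beta> * H n" if "M \<le> n" "n \<le> k" for n k
    using that
  proof (induction "k - n" arbitrary: n rule: less_induct)
    case less
    have n: "n \<ge> 1" using less.prems by (simp add: M_def)
    show ?case
    proof (cases "k < 2 * n")
      case True
      have "H k \<le> 2 powr \<beta> * 1 * H n" using mon[of k "2 * n"] True M[OF less.prems(1)] by simp
      also have "\<dots> \<le> 2 powr \<beta> * (real k / real n) powr \<beta> * H n"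
        using pos[of n] n be less.prems
        by (intro mult_right_mono mult_left_mono) (auto intro!: ge_one_powr_ge_zero)
      finally show ?thesis .
    next
      case False
      then have "H k \<le> 2 powr \<beta> * (real k / real (2 * n)) powr \<beta> * H (2 * n)"
        using less.prems n by (intro less.hyps) auto
      also have "\<dots> \<le> 2 powr \<beta> * (real k / real (2 * n)) powr \<beta> * (2 powr \<beta> * H n)"
        using M[OF less.prems(1)] by (intro mult_left_mono) auto
      also have "(real k / real (2 * n)) powr \<beta> * 2 powr \<beta> = (real k / real n) powr \<beta>"
        by (subst powr_mult[symmetric]) (auto simp: field_simps)
      then have "2 powr \<beta> * (real k / real (2 * n)) powr \<beta> * (2 powr \<beta> * H n) =
          2 powr \<beta> * (real k / real n) powr \<beta> * H n" by (simp add: mult_ac)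
      finally show ?thesis .
    qed
  qed
  have "H k / H n \<le> 2 powr \<beta> * H M * (real k / real n) powr \<beta>" if nk: "1 \<le> n" "n \<le> k" for n k
  proof -
    have r: "1 \<le> (real k / real n) powr \<beta>"
      using nk be by (intro ge_one_powr_ge_zero) auto
    have two: "1 \<le> 2 powr \<beta>" using be by (intro ge_one_powr_ge_zero) auto
    have "H k \<le> 2 powr \<beta> * (real k / real n) powr \<beta> * H M * H n"
    proof -
      consider "M \<le> n" | "n < M" "M \<le> k" | "k < M" by linarith
      then show ?thesis
      proof cases
        case 1
        have "H k \<le> 2 powr \<beta> * (real k / real n) powr \<beta> * H n * 1" using big[OF 1 nk(2)] by simp
        also have "\<dots> \<le> 2 powr \<beta> * (real k / real n) powr \<beta> * H n * H M"
          using H1 pos by (intro mult_left_mono) (auto simp: less_imp_le)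
        finally show ?thesis by (simp add: mult_ac)
      next
        case 2
        have "H k \<le> 2 powr \<beta> * (real k / real M) powr \<beta> * H M" by (rule big) (use 2 in auto)
        also have "\<dots> \<le> 2 powr \<beta> * (real k / real n) powr \<beta> * H M"
          using 2 nk pos be
          by (intro mult_right_mono mult_left_mono powr_mono2 divide_left_mono) (auto simp: less_imp_le)
        also have "\<dots> = 2 powr \<beta> * (real k / real n) powr \<beta> * H M * 1" by simp
        also have "\<dots> \<le> 2 powr \<beta> * (real k / real n) powr \<beta> * H M * H n"
          using H1 pos by (intro mult_left_mono) (auto simp: less_imp_le)
        finally show ?thesis .
      next
        case 3
        have "H k \<le> 1 * 1 * H M * 1" using mon[of k M] 3 by simp
        also have "\<dots> \<le> 2 powr \<beta> * (real k / real n) powr \<beta> * H M * H n"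
          using r two H1 pos by (intro mult_mono) (auto simp: less_imp_le)
        finally show ?thesis .
      qed
    qed
    then show ?thesis using pos[of n] by (simp add: field_simps)
  qed
  moreover have "2 powr \<beta> * H M > 0" using pos by simp
  ultimately show ?thesis by blast
qed

text \<open>Potter's bound for \<open>k \<le> n\<close>: here doubling multiplies \<^term>\<open>H\<close> by at least
  \<open>2 powr \<gamma>\<close>.\<close>

lemma potter_lower:
  fixes H :: "nat \<Rightarrow> real"
  assumes mono: "mono H" and pos: "\<And>n. H n > 0" and ga: "\<gamma> < \<alpha>" "\<gamma> > 0"
    and reg: "(\<lambda>n. H (2 * n) / H n) \<longlonglongrightarrow> 2 powr \<alpha>"
  shows "\<exists>A>0. \<forall>n k. 1 \<le> k \<longrightarrow> k \<le> n \<longrightarrow> H k / H n \<le> A * (real k / real n) powr \<gamma>"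
proof -
  have "2 powr \<gamma> < 2 powr \<alpha>" using ga by simp
  then have "eventually (\<lambda>n. 2 powr \<gamma> < H (2 * n) / H n) at_top"
    by (rule order_tendstoD(1)[OF reg])
  then obtain m where m0: "\<And>n. n \<ge> m \<Longrightarrow> 2 powr \<gamma> < H (2 * n) / H n"
    unfolding eventually_at_top_linorder by blast
  define M where "M = max m 1"
  have M: "H n * 2 powr \<gamma> \<le> H (2 * n)" if "n \<ge> M" for n
    using m0[of n] that pos[of n] by (simp add: M_def field_simps)
  have mon: "H i \<le> H j" if "i \<le> j" for i j using mono that by (simp add: mono_def)
  have big: "H k \<le> 2 powr \<gamma> * (real k / real n) powr \<gamma> * H n" if "M \<le> k" "k \<le> n" for n k
    using that
  proof (induction "n - k" arbitrary: k rule: less_induct)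
    case less
    have k: "k \<ge> 1" using less.prems by (simp add: M_def)
    show ?case
    proof (cases "n < 2 * k")
      case True
      have "1 \<le> (2 * (real k / real n)) powr \<gamma>"
        using True k ga less.prems by (intro ge_one_powr_ge_zero) (auto simp: field_simps)
      also have "\<dots> = 2 powr \<gamma> * (real k / real n) powr \<gamma>" by (rule powr_mult) 
      finally have "1 * H n \<le> 2 powr \<gamma> * (real k / real n) powr \<gamma> * H n"
        using pos[of n] by (intro mult_right_mono) auto
      then show ?thesis using mon[OF less.prems(2)] by simp
    next
      case False
      have "H k * 2 powr \<gamma> \<le> H (2 * k)" by (rule M[OF less.prems(1)])
      also have "\<dots> \<le> 2 powr \<gamma> * (real (2 * k) / real n) powr \<gamma> * H n"
        using False less.prems k by (intro less.hyps) auto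
      also have "(real (2 * k) / real n) powr \<gamma> = 2 powr \<gamma> * (real k / real n) powr \<gamma>"
        by (subst powr_mult[symmetric]) auto
      finally show ?thesis by (simp add: mult_ac)
    qed
  qed
  have M1: "M \<ge> 1" by (simp add: M_def)
  have "H k / H n \<le> (2 * real M) powr \<gamma> * (real k / real n) powr \<gamma>" if nk: "1 \<le> k" "k \<le> n" for n k
  proof -
    have "H k \<le> (2 * real M) powr \<gamma> * (real k / real n) powr \<gamma> * H n"
    proof -
      have MM: "2 powr \<gamma> \<le> (2 * real M) powr \<gamma>" using M1 ga by (intro powr_mono2) auto
      consider "M \<le> k" | "k < M" "M \<le> n" | "n < M" by linarith
      then show ?thesis
      proof cases
        case 1
        have "H k \<le> 2 powr \<gamma> * (real k / real n) powr \<gamma> * H n" by (rule big[OF 1 nk(2)])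
        also have "\<dots> \<le> (2 * real M) powr \<gamma> * (real k / real n) powr \<gamma> * H n"
          using MM pos[of n] by (intro mult_right_mono) auto
        finally show ?thesis .
      next
        case 2
        have "H k \<le> H M" using 2 mon by simp
        also have "\<dots> \<le> 2 powr \<gamma> * (real M / real n) powr \<gamma> * H n" by (rule big) (use 2 in auto)
        also have "2 powr \<gamma> * (real M / real n) powr \<gamma> = (2 * real M / real n) powr \<gamma>"
          by (subst powr_mult[symmetric]) auto
        also have "\<dots> \<le> (2 * real M * (real k / real n)) powr \<gamma>"
          using nk ga M1 by (intro powr_mono2) (auto simp: field_simps)
        also have "\<dots> = (2 * real M) powr \<gamma> * (real k / real n) powr \<gamma>" by (rule powr_mult)
        finally show ?thesis using pos[of n] by simp
      next
        case 3
        have "1 \<le> (2 * real M * (real k / real n)) powr \<gamma>"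
        proof (rule ge_one_powr_ge_zero)
          have "real n * 1 \<le> real M * (2 * real k)" using 3 nk by (intro mult_mono) auto
          then show "1 \<le> 2 * real M * (real k / real n)" using nk by (simp add: field_simps)
        qed (use ga in simp)
        also have "\<dots> = (2 * real M) powr \<gamma> * (real k / real n) powr \<gamma>" by (rule powr_mult)
        finally have "1 * H n \<le> (2 * real M) powr \<gamma> * (real k / real n) powr \<gamma> * H n"
          using pos[of n] by (intro mult_right_mono) auto
        then show ?thesis using mon[OF nk(2)] by simp
      qed
    qed
    then show ?thesis using pos[of n] by (simp add: field_simps)
  qed
  moreover have "(2 * real M) powr \<gamma> > 0" using M1 by simp
  ultimately show ?thesis by blast
qed

section \<open>Sums as integrals, and the beta prime integral\<close>

text \<open>The map \<open>u \<mapsto> \<lfloor>u n\<rfloor>\<close> sends Lebesgue measure on the half-line to \<open>1 / n\<close> times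
  counting measure.\<close>

lemma scaled_step_integral:
  fixes f :: "nat \<Rightarrow> real"
  assumes f: "summable (\<lambda>k. \<bar>f k\<bar>)" and n: "n > 0"
  shows "(\<integral>u. indicator {0..} u * f (nat \<lfloor>u * real n\<rfloor>) \<partial>lborel) = (\<Sum>k. f k) / real n"
proof -
  define g where "g u = nat \<lfloor>u * real n\<rfloor>" for u
  have g[measurable]: "g \<in> measurable borel (count_space UNIV)"
    unfolding g_def by measurable
  let ?P = "density lborel (\<lambda>u. ennreal (indicator {0..} u)) :: real measure"
  let ?D = "distr ?P (count_space UNIV) g"
  let ?N = "density (count_space UNIV) (\<lambda>_::nat. ennreal (1 / real n))"
  have "?D = ?N"
  proof (rule measure_eqI_countable)
    fix k :: nat
    have eq: "{0..} \<inter> g -` {k} = {real k / real n..<(real k + 1) / real n}"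
    proof -
      have "(0 \<le> u \<and> nat \<lfloor>u * real n\<rfloor> = k) \<longleftrightarrow> (real k \<le> u * real n \<and> u * real n < real k + 1)" for u
      proof
        assume u: "0 \<le> u \<and> nat \<lfloor>u * real n\<rfloor> = k"
        then have "\<lfloor>u * real n\<rfloor> = int k" using n by force
        then show "real k \<le> u * real n \<and> u * real n < real k + 1" by linarith
      next
        assume u: "real k \<le> u * real n \<and> u * real n < real k + 1"
        then have "\<lfloor>u * real n\<rfloor> = int k" by linarith
        moreover have "0 \<le> u" using u n by (smt (verit) mult_neg_pos of_nat_0_le_iff of_nat_0_less_iff)
        ultimately show "0 \<le> u \<and> nat \<lfloor>u * real n\<rfloor> = k" by simp
      qed
      moreover have "(real k \<le> u * real n \<and> u * real n < real k + 1) \<longleftrightarrow>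
          u \<in> {real k / real n..<(real k + 1) / real n}" for u
        using n by (simp add: pos_divide_le_eq pos_less_divide_eq)
      ultimately show ?thesis by (simp add: g_def set_eq_iff)
    qed
    have "emeasure ?D {k} = emeasure ?P (g -` {k})"
      by (subst emeasure_distr) (use g in simp_all)
    also have "\<dots> = (\<integral>\<^sup>+u. indicator ({0..} \<inter> g -` {k}) u \<partial>lborel)"
      by (subst emeasure_density) (auto intro!: nn_integral_cong simp: indicator_def
          measurable_sets_borel[OF g])
    also have "\<dots> = ennreal (1 / real n)"
      unfolding eq using n by (simp add: diff_divide_distrib[symmetric] divide_right_mono)
    finally show "emeasure ?D {k} = emeasure ?N {k}"
      by (simp add: emeasure_density)
  qed auto
  then have "(\<integral>k. f k \<partial>?D) = (\<integral>k. f k \<partial>?N)" by simp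
  moreover have "(\<integral>k. f k \<partial>?D) = (\<integral>u. indicator {0..} u * f (g u) \<partial>lborel)"
    by (subst integral_distr) (auto simp: integral_density)
  moreover have "(\<integral>k. f k \<partial>?N) = (\<Sum>k. f k) / real n"
    using f by (subst integral_density)
      (auto simp: integral_count_space_nat integrable_count_space_nat_iff)
  ultimately show ?thesis by (simp add: g_def)
qed

lemma set_integrable_lborel_of_nonneg_integral:
  fixes f :: "real \<Rightarrow> real"
  assumes "(f has_integral I) S" "\<And>x. x \<in> S \<Longrightarrow> 0 \<le> f x"
    and [measurable]: "f \<in> borel_measurable borel" "S \<in> sets borel"
  shows "set_integrable lborel S f"
proof -
  have "f absolutely_integrable_on S"
    using assms by (intro nonnegative_absolutely_integrable_1) auto
  then show ?thesis unfolding set_integrable_def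
    by (subst (asm) integrable_completion) auto
qed

text \<open>The majorant for dominated convergence: an integrable singularity at \<open>0\<close> glued to an
  integrable tail.\<close>

lemma powr_majorant_integrable:
  fixes a b :: real
  assumes "a > -1" "b < -1"
  shows "integrable lborel (\<lambda>u. indicator {0<..} u * (if u \<le> 1 then u powr a else u powr b))"
proof -
  have 1: "set_integrable lborel {0..1} (\<lambda>u. u powr a)"
    by (rule set_integrable_lborel_of_nonneg_integral[OF has_integral_powr_from_0]) (use assms in auto)
  have 2: "set_integrable lborel {1..} (\<lambda>u. u powr b)"
    by (rule set_integrable_lborel_of_nonneg_integral[OF has_integral_powr_to_inf]) (use assms in auto)
  have "integrable lborel (\<lambda>u. indicator {0..1} u *\<^sub>R u powr a + indicator {1..} u *\<^sub>R u powr b)"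
    using 1 2 unfolding set_integrable_def by (rule Bochner_Integration.integrable_add)
  then show ?thesis
    by (rule Bochner_Integration.integrable_bound)
      (auto simp: indicator_def intro!: AE_I2)
qed

text \<open>The substitution \<open>u = t / (1 - t)\<close> turns this into the Beta integral over the unit interval.\<close>

lemma beta_prime_integral:
  fixes \<alpha> :: real
  assumes "0 < \<alpha>" "\<alpha> < 1/2"
  shows "integrable lborel (\<lambda>u. indicator {0<..} u * (u powr (\<alpha> - 1) * (1 + u) powr (\<alpha> - 1)))"
    and "(\<integral>u. indicator {0<..} u * (u powr (\<alpha> - 1) * (1 + u) powr (\<alpha> - 1)) \<partial>lborel) = Beta \<alpha> (1 - 2 * \<alpha>)"
proof -
  let ?f = "\<lambda>u::real. u powr (\<alpha> - 1) * (1 + u) powr (\<alpha> - 1)"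
  let ?g = "\<lambda>t::real. t / (1 - t)" and ?g' = "\<lambda>t::real. 1 / (1 - t)\<^sup>2"
  let ?S = "{0<..<1::real}"
  have beta: "((\<lambda>t. t powr (\<alpha> - 1) * (1 - t) powr ((1 - 2 * \<alpha>) - 1)) has_integral Beta \<alpha> (1 - 2 * \<alpha>)) ?S"
    unfolding has_integral_Icc_iff_Ioo[symmetric]
    by (rule has_integral_Beta_real) (use assms in auto)
  have eq: "\<bar>?g' t\<bar> * ?f (?g t) = t powr (\<alpha> - 1) * (1 - t) powr ((1 - 2 * \<alpha>) - 1)" if "t \<in> ?S" for t
  proof -
    have t: "0 < t" "0 < 1 - t" using that by auto
    have "1 + t / (1 - t) = 1 / (1 - t)" using t by (simp add: field_simps)
    moreover have "(1 - t) powr (1 - \<alpha>) = 1 / (1 - t) powr (\<alpha> - 1)"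
      using powr_minus_divide[of "1 - t" "\<alpha> - 1"] by simp
    ultimately have "\<bar>?g' t\<bar> * ?f (?g t) =
        (1 - t) powr (-2) * (t powr (\<alpha> - 1) * (1 - t) powr (- (\<alpha> - 1)) * (1 - t) powr (- (\<alpha> - 1)))"
      using t by (simp add: powr_divide powr_minus_divide power2_eq_square powr_numeral)
    also have "\<dots> = t powr (\<alpha> - 1) * ((1 - t) powr (-2) * (1 - t) powr (- (\<alpha> - 1)) * (1 - t) powr (- (\<alpha> - 1)))"
      by (simp add: mult_ac)
    also have "\<dots> = t powr (\<alpha> - 1) * (1 - t) powr ((1 - 2 * \<alpha>) - 1)"
      by (simp only: powr_add[symmetric]) (simp add: algebra_simps)
    finally show ?thesis .
  qed
  have image: "?g ` ?S = {0<..}"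
  proof
    show "{0<..} \<subseteq> ?g ` ?S"
    proof
      fix x :: real assume "x \<in> {0<..}"
      then show "x \<in> ?g ` ?S"
        by (intro image_eqI[of _ _ "x / (1 + x)"]) (auto simp: field_simps)
    qed
  qed auto
  have int: "((\<lambda>t. \<bar>?g' t\<bar> * ?f (?g t)) has_integral Beta \<alpha> (1 - 2 * \<alpha>)) ?S"
    by (subst has_integral_cong[OF eq]) (use beta in auto)
  then have "(\<lambda>t. \<bar>?g' t\<bar> * ?f (?g t)) absolutely_integrable_on ?S"
    by (intro nonnegative_absolutely_integrable_1) auto
  moreover have "(\<lambda>t. \<bar>?g' t\<bar> * ?f (?g t)) absolutely_integrable_on ?S \<and>
      integral ?S (\<lambda>t. \<bar>?g' t\<bar> * ?f (?g t)) = Beta \<alpha> (1 - 2 * \<alpha>) \<longleftrightarrow>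
      ?f absolutely_integrable_on ?g ` ?S \<and> integral (?g ` ?S) ?f = Beta \<alpha> (1 - 2 * \<alpha>)"
  proof (rule has_absolute_integral_change_of_variables_1')
    show "(?g has_field_derivative ?g' t) (at t within ?S)" if "t \<in> ?S" for t
      using that by (auto intro!: derivative_eq_intros simp: power2_eq_square)
    show "inj_on ?g ?S" by (auto simp: inj_on_def field_simps)
  qed simp
  ultimately have f: "?f absolutely_integrable_on {0<..}" "integral {0<..} ?f = Beta \<alpha> (1 - 2 * \<alpha>)"
    using int unfolding image by blast+
  have s: "set_integrable lborel {0<..} ?f"
    using f(1) unfolding set_integrable_def by (subst (asm) integrable_completion) auto
  then show "integrable lborel (\<lambda>u. indicator {0<..} u * ?f u)"
    by (simp add: set_integrable_def)
  show "(\<integral>u. indicator {0<..} u * ?f u \<partial>lborel) = Beta \<alpha> (1 - 2 * \<alpha>)"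
    using set_borel_integral_eq_integral(2)[OF s] f(2) by (simp add: set_lebesgue_integral_def)
qed

section \<open>The scaling limit of the sums of products\<close>

lemma floor_ratio_limit:
  assumes u: "u > 0"
  shows "(\<lambda>n. real (nat \<lfloor>u * real n\<rfloor>) / real n) \<longlonglongrightarrow> u"
proof (rule tendsto_sandwich)
  have fl: "real (nat \<lfloor>u * real n\<rfloor>) = of_int \<lfloor>u * real n\<rfloor>" for n using u by simp
  show "eventually (\<lambda>n. u - 1 / real n \<le> real (nat \<lfloor>u * real n\<rfloor>) / real n) at_top"
  proof (rule eventually_sequentiallyI[of 1])
    fix n :: nat assume n: "1 \<le> n"
    have "(u * real n - 1) / real n \<le> real (nat \<lfloor>u * real n\<rfloor>) / real n"
      unfolding fl by (intro divide_right_mono) linarith+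
    then show "u - 1 / real n \<le> real (nat \<lfloor>u * real n\<rfloor>) / real n"
      using n by (simp add: diff_divide_distrib)
  qed
  show "eventually (\<lambda>n. real (nat \<lfloor>u * real n\<rfloor>) / real n \<le> u) at_top"
  proof (rule eventually_sequentiallyI[of 1])
    fix n :: nat assume n: "1 \<le> n"
    have "real (nat \<lfloor>u * real n\<rfloor>) / real n \<le> (u * real n) / real n"
      unfolding fl by (intro divide_right_mono) linarith+
    then show "real (nat \<lfloor>u * real n\<rfloor>) / real n \<le> u" using n by simp
  qed
  have "(\<lambda>n. u - 1 / real n) \<longlonglongrightarrow> u - 0" by (intro tendsto_intros lim_1_over_n)
  then show "(\<lambda>n. u - 1 / real n) \<longlonglongrightarrow> u" by simp
qed simp

text \<open>Weights \<open>q n \<sim> C * H n / n\<close> with \<^term>\<open>H\<close> increasing and regularly varying of index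
  \<open>\<alpha>\<close>. For renewal weights, \<^term>\<open>H\<close> is the reciprocal of the tail of the step law; it takes
  the place of \<open>n powr \<alpha> / L n\<close>, which need not be monotone.\<close>

locale regular_weights =
  fixes q H :: "nat \<Rightarrow> real" and \<alpha> C :: real
  assumes alpha: "0 < \<alpha>" "\<alpha> < 1/2"
    and H_mono: "mono H" and H_ge_1: "\<And>n. H n \<ge> 1"
    and H_regular: "\<And>c. c > 0 \<Longrightarrow> (\<lambda>n. H (c * n) / H n) \<longlonglongrightarrow> real c powr \<alpha>"
    and q_nonneg: "\<And>n. q n \<ge> 0"
    and C_pos: "C > 0"
    and q_asymp: "(\<lambda>n. q n * real n / H n) \<longlonglongrightarrow> C"
begin

lemma H_pos: "H n > 0"
  using H_ge_1[of n] by linarith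

text \<open>The order of magnitude of \<open>q n\<close>.\<close>

definition scale :: "nat \<Rightarrow> real" where "scale n = H n / real n"

text \<open>Comparing with \<open>Suc k\<close> instead of \<open>k\<close> makes the bound meaningful at \<open>k = 0\<close> too.\<close>

lemma q_le_scale: "\<exists>A>0. \<forall>k. q k \<le> A * scale (Suc k)"
proof -
  obtain K where K: "K > 0" "\<And>n. norm (q n * real n / H n) \<le> K"
    using BseqE[OF convergent_imp_Bseq[OF convergentI[OF q_asymp]]] by blast
  have "q k \<le> (2 * K + q 0) * scale (Suc k)" for k
  proof (cases "k = 0")
    case True
    have "q 0 * 1 \<le> (2 * K + q 0) * H 1"
      using K(1) q_nonneg[of 0] H_ge_1 by (intro mult_mono) auto
    then show ?thesis using True by (simp add: scale_def)
  next
    case False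
    then have k: "real k > 0" by simp
    have "q k * real k / H k \<le> K" using K(2)[of k] by (simp only: real_norm_def abs_le_iff)
    then have "q k \<le> K * (H k / real k)" using k H_pos[of k] by (simp add: field_simps)
    also have "\<dots> \<le> K * (2 * (H (Suc k) / real (Suc k)))"
    proof (intro mult_left_mono)
      have "H k / real k \<le> H (Suc k) / real k"
        using H_mono k by (intro divide_right_mono) (auto simp: mono_def)
      also have "\<dots> \<le> 2 * (H (Suc k) / real (Suc k))"
      proof -
        have "H (Suc k) * (1 + real k) \<le> H (Suc k) * (2 * real k)"
          using False H_pos[of "Suc k"] by (intro mult_left_mono) auto
        then show ?thesis using k by (simp add: field_simps)
      qed
      finally show "H k / real k \<le> 2 * (H (Suc k) / real (Suc k))" .
    qed (use K in simp)
    also have "\<dots> = 2 * K * scale (Suc k) + 0" by (simp add: scale_def)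
    also have "\<dots> \<le> 2 * K * scale (Suc k) + q 0 * scale (Suc k)"
      using q_nonneg[of 0] H_pos[of "Suc k"] by (intro add_left_mono) (simp add: scale_def)
    finally show ?thesis by (simp add: distrib_right)
  qed
  moreover have "2 * K + q 0 > 0" using K q_nonneg[of 0] by simp
  ultimately show ?thesis by blast
qed

text \<open>The slack in Potter's bounds. It is so small that \<open>\<alpha> - \<eta> - 1 > - 1\<close> and
  \<open>2 * (\<alpha> + \<eta> - 1) < - 1\<close>: the resulting majorants stay integrable at \<open>0\<close> and at infinity. The
  second requirement can be met because \<open>\<alpha> < 1/2\<close>.\<close>

definition \<eta> :: real where "\<eta> = min \<alpha> (1/2 - \<alpha>) / 2"

lemma eta: "\<eta> > 0" "\<eta> < \<alpha>" "\<alpha> + \<eta> < 1/2"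
  using alpha by (auto simp: \<eta>_def min_def)

lemma scale_ratio_bound:
  "\<exists>A>0. \<forall>n k u. 1 \<le> n \<longrightarrow> 1 \<le> k \<longrightarrow> 0 < u \<longrightarrow> u * real n \<le> real k \<longrightarrow>
     scale k / scale n \<le> A * (if u \<le> 1 then u powr (\<alpha> - \<eta> - 1) else u powr (\<alpha> + \<eta> - 1))"
proof -
  have reg2: "(\<lambda>n. H (2 * n) / H n) \<longlonglongrightarrow> 2 powr \<alpha>" using H_regular[of 2] by simp
  obtain A1 where A1: "A1 > 0" "\<And>n k. 1 \<le> n \<Longrightarrow> n \<le> k \<Longrightarrow> H k / H n \<le> A1 * (real k / real n) powr (\<alpha> + \<eta>)"
    using potter_upper[OF H_mono H_ge_1 _ _ reg2, of "\<alpha> + \<eta>"] eta alpha by auto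
  obtain A2 where A2: "A2 > 0" "\<And>n k. 1 \<le> k \<Longrightarrow> k \<le> n \<Longrightarrow> H k / H n \<le> A2 * (real k / real n) powr (\<alpha> - \<eta>)"
    using potter_lower[OF H_mono H_pos _ _ reg2, of "\<alpha> - \<eta>"] eta alpha by auto
  have conv: "scale k / scale n \<le> A * (real k / real n) powr (s - 1)"
    if "H k / H n \<le> A * (real k / real n) powr s" "1 \<le> n" "1 \<le> k" for A s n k
  proof -
    have "scale k / scale n = (H k / H n) / (real k / real n)" by (simp add: scale_def)
    also have "\<dots> \<le> A * (real k / real n) powr s / (real k / real n)"
      using that by (intro divide_right_mono) auto
    also have "\<dots> = A * (real k / real n) powr (s - 1)"
      using that by (simp add: powr_diff)
    finally show ?thesis .
  qed
  have "scale k / scale n \<le> (A1 + A2) * (if u \<le> 1 then u powr (\<alpha> - \<eta> - 1) else u powr (\<alpha> + \<eta> - 1))"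
    if nk: "1 \<le> n" "1 \<le> k" and u: "0 < u" "u * real n \<le> real k" for n k u
  proof -
    have r: "u \<le> real k / real n" using nk u by (simp add: field_simps)
    show ?thesis
    proof (cases "n \<le> k")
      case True
      have "scale k / scale n \<le> A1 * (real k / real n) powr (\<alpha> + \<eta> - 1)"
        using conv[OF A1(2)] nk True by simp
      also have "\<dots> \<le> A1 * u powr (\<alpha> + \<eta> - 1)"
        using r u A1(1) eta by (intro mult_left_mono powr_mono2') auto
      also have "\<dots> \<le> A1 * (if u \<le> 1 then u powr (\<alpha> - \<eta> - 1) else u powr (\<alpha> + \<eta> - 1))"
        using u A1(1) eta by (intro mult_left_mono) (auto intro!: powr_mono')
      also have "\<dots> \<le> (A1 + A2) * (if u \<le> 1 then u powr (\<alpha> - \<eta> - 1) else u powr (\<alpha> + \<eta> - 1))"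
        using A2(1) by (intro mult_right_mono) auto
      finally show ?thesis .
    next
      case False
      then have "real k / real n \<le> 1" using nk by simp
      then have u1: "u \<le> 1" using r by linarith
      have "scale k / scale n \<le> A2 * (real k / real n) powr (\<alpha> - \<eta> - 1)"
        using conv[OF A2(2)] nk False by simp
      also have "\<dots> \<le> A2 * u powr (\<alpha> - \<eta> - 1)"
        using r u A2(1) eta by (intro mult_left_mono powr_mono2') auto
      also have "\<dots> \<le> (A1 + A2) * u powr (\<alpha> - \<eta> - 1)"
        using A1(1) by (intro mult_right_mono) auto
      finally show ?thesis using u1 by simp
    qed
  qed
  moreover have "A1 + A2 > 0" using A1 A2 by simp
  ultimately show ?thesis by blast
qed

lemma summable_q_square: "summable (\<lambda>k. (q k)\<^sup>2)"
proof -
  obtain A where A: "A > 0" "\<And>k. q k \<le> A * scale (Suc k)" using q_le_scale by blast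
  obtain A' where A': "A' > 0" "\<And>n k u. 1 \<le> n \<Longrightarrow> 1 \<le> k \<Longrightarrow> 0 < u \<Longrightarrow> u * real n \<le> real k \<Longrightarrow>
     scale k / scale n \<le> A' * (if u \<le> 1 then u powr (\<alpha> - \<eta> - 1) else u powr (\<alpha> + \<eta> - 1))"
    using scale_ratio_bound by metis
  have scale_1: "scale 1 = H 1" by (simp add: scale_def)
  define B where "B = A * (A' * H 1)"
  have B: "q k \<le> B * real (Suc k) powr (\<alpha> + \<eta> - 1)" for k
  proof -
    have "scale (Suc k) / scale 1 \<le> A' * real (Suc k) powr (\<alpha> + \<eta> - 1)"
      using A'(2)[of 1 "Suc k" "real (Suc k)"] by (cases "k = 0") simp_all
    then have "scale (Suc k) \<le> A' * H 1 * real (Suc k) powr (\<alpha> + \<eta> - 1)"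
      using H_pos[of 1] scale_1 by (simp add: pos_divide_le_eq mult_ac del: of_nat_Suc)
    then have "A * scale (Suc k) \<le> A * (A' * H 1 * real (Suc k) powr (\<alpha> + \<eta> - 1))"
      using A(1) by (intro mult_left_mono) auto
    then show ?thesis using A(2)[of k] by (simp add: B_def mult.assoc)
  qed
  have "summable (\<lambda>k. real k powr (2 * (\<alpha> + \<eta> - 1)))"
    using eta by (simp add: summable_real_powr_iff)
  then have "summable (\<lambda>k. B\<^sup>2 * real (Suc k) powr (2 * (\<alpha> + \<eta> - 1)))"
    by (intro summable_mult) (rule summable_Suc_iff[THEN iffD2])
  then show ?thesis
  proof (rule summable_comparison_test[rotated])
    have "(q k)\<^sup>2 \<le> B\<^sup>2 * real (Suc k) powr (2 * (\<alpha> + \<eta> - 1))" for k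
    proof -
      have "(q k)\<^sup>2 \<le> (B * real (Suc k) powr (\<alpha> + \<eta> - 1))\<^sup>2"
        using B q_nonneg by (intro power_mono) auto
      also have "\<dots> = B\<^sup>2 * real (Suc k) powr (2 * (\<alpha> + \<eta> - 1))"
        by (simp only: power_mult_distrib power2_eq_square[of "_ powr _"] powr_add[symmetric] mult_2)
      finally show ?thesis .
    qed
    then show "\<exists>N. \<forall>k\<ge>N. norm ((q k)\<^sup>2) \<le> B\<^sup>2 * real (Suc k) powr (2 * (\<alpha> + \<eta> - 1))" by auto
  qed
qed

lemma summable_q_product: "summable (\<lambda>k. q k * q (n + k))"
proof (rule summable_comparison_test)
  have "norm (q k * q (n + k)) \<le> (q k)\<^sup>2 + (q (k + n))\<^sup>2" for k
  proof -
    have "0 \<le> (q k - q (n + k))\<^sup>2" "0 \<le> q k * q (n + k)" using q_nonneg by simp_all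
    then have "2 * (q k * q (n + k)) \<le> (q k)\<^sup>2 + (q (k + n))\<^sup>2"
      by (simp add: power2_diff add.commute)
    then show ?thesis using \<open>0 \<le> q k * q (n + k)\<close> by simp
  qed
  then show "\<exists>N. \<forall>k\<ge>N. norm (q k * q (n + k)) \<le> (q k)\<^sup>2 + (q (k + n))\<^sup>2" by blast
  show "summable (\<lambda>k. (q k)\<^sup>2 + (q (k + n))\<^sup>2)"
    by (intro summable_add summable_q_square summable_ignore_initial_segment[OF summable_q_square])
qed

text \<open>The density emerges here: at distance about \<open>u n\<close>, the weight relative to \<open>q n\<close> is
  \<open>u powr \<alpha> / u\<close>.\<close>

lemma q_scaled_limit:
  assumes k: "(\<lambda>n. real (k n) / real n) \<longlonglongrightarrow> u" and u: "u > 0"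
  shows "(\<lambda>n. q (k n) / scale n) \<longlonglongrightarrow> C * u powr (\<alpha> - 1)"
proof -
  have "filterlim (\<lambda>n. (real (k n) / real n) * real n) at_top at_top"
    by (rule filterlim_tendsto_pos_mult_at_top[OF k u filterlim_real_sequentially])
  moreover have "filterlim (\<lambda>n. (real (k n) / real n) * real n) at_top at_top \<longleftrightarrow>
      filterlim (\<lambda>n. real (k n)) at_top at_top"
    by (rule filterlim_cong[OF refl refl], rule eventually_sequentiallyI[of 1]) simp
  ultimately have "filterlim (\<lambda>n. real (k n)) at_top at_top" by simp
  then have k_top: "filterlim k at_top at_top"
    by (simp add: filterlim_sequentially_iff_filterlim_real)
  have L: "(\<lambda>n. (q (k n) * real (k n) / H (k n)) * (H (k n) / H n) / (real (k n) / real n))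
      \<longlonglongrightarrow> C * u powr \<alpha> / u"
    using u by (intro tendsto_intros filterlim_compose[OF q_asymp k_top] k
      monotone_ratio_limit[OF H_mono H_pos alpha(1) H_regular k]) auto
  have ev: "eventually (\<lambda>n. (q (k n) * real (k n) / H (k n)) * (H (k n) / H n) / (real (k n) / real n)
      = q (k n) / scale n) at_top"
  proof -
    have "eventually (\<lambda>n. 1 \<le> k n) at_top"
      using k_top by (simp add: filterlim_at_top)
    then show ?thesis using eventually_gt_at_top[of 0]
    proof eventually_elim
      case (elim n)
      then show ?case using H_pos[of "k n"] H_pos[of n] by (simp add: scale_def field_simps)
    qed
  qed
  have "C * u powr \<alpha> / u = C * u powr (\<alpha> - 1)"
    using u by (simp add: powr_diff)
  then show ?thesis using Lim_transform_eventually[OF L ev] by simp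
qed

text \<open>For \<open>u \<le> 1\<close> the second factor is bounded and the first gives the singularity; for
  \<open>u > 1\<close> both factors decay at the same rate.\<close>

lemma q_product_dominated:
  "\<exists>A>0. \<forall>n u. 1 \<le> n \<longrightarrow> 0 < u \<longrightarrow>
     q (nat \<lfloor>u * real n\<rfloor>) * q (n + nat \<lfloor>u * real n\<rfloor>) / (scale n)\<^sup>2 \<le>
     A * (if u \<le> 1 then u powr (\<alpha> - \<eta> - 1) else u powr (2 * (\<alpha> + \<eta> - 1)))"
proof -
  obtain A where A: "A > 0" "\<And>k. q k \<le> A * scale (Suc k)" using q_le_scale by blast
  obtain A' where A': "A' > 0" "\<And>n k u. 1 \<le> n \<Longrightarrow> 1 \<le> k \<Longrightarrow> 0 < u \<Longrightarrow> u * real n \<le> real k \<Longrightarrow>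
     scale k / scale n \<le> A' * (if u \<le> 1 then u powr (\<alpha> - \<eta> - 1) else u powr (\<alpha> + \<eta> - 1))"
    using scale_ratio_bound by metis
  have "q (nat \<lfloor>u * real n\<rfloor>) * q (n + nat \<lfloor>u * real n\<rfloor>) / (scale n)\<^sup>2 \<le>
     (A * A')\<^sup>2 * (if u \<le> 1 then u powr (\<alpha> - \<eta> - 1) else u powr (2 * (\<alpha> + \<eta> - 1)))"
    if n: "1 \<le> n" and u: "0 < u" for n u
  proof -
    let ?k = "nat \<lfloor>u * real n\<rfloor>"
    have sc: "scale n > 0" using n H_pos[of n] by (simp add: scale_def)
    have k: "u * real n \<le> real (Suc ?k)" using u by simp linarith
    have b: "q j / scale n \<le> A * A' * (if v \<le> 1 then v powr (\<alpha> - \<eta> - 1) else v powr (\<alpha> + \<eta> - 1))"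
      if "0 < v" "v * real n \<le> real (Suc j)" for j v
    proof -
      have "q j / scale n \<le> A * scale (Suc j) / scale n"
        using A(2) sc by (intro divide_right_mono) auto
      also have "\<dots> = A * (scale (Suc j) / scale n)" by simp
      also have "\<dots> \<le> A * (A' * (if v \<le> 1 then v powr (\<alpha> - \<eta> - 1) else v powr (\<alpha> + \<eta> - 1)))"
        using A(1) n that by (intro mult_left_mono A'(2)) auto
      finally show ?thesis by (simp add: mult.assoc)
    qed
    have b1: "q ?k / scale n \<le> A * A' * (if u \<le> 1 then u powr (\<alpha> - \<eta> - 1) else u powr (\<alpha> + \<eta> - 1))"
      by (rule b[OF u k])
    have "q (n + ?k) / scale n \<le> A * A' * (1 + u) powr (\<alpha> + \<eta> - 1)"
      using b[of "1 + u" "n + ?k"] u k by (simp add: distrib_right)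
    also have "\<dots> \<le> A * A' * (if u \<le> 1 then 1 else u powr (\<alpha> + \<eta> - 1))"
    proof (intro mult_left_mono)
      have "(1 + u) powr (\<alpha> + \<eta> - 1) \<le> 1 powr (\<alpha> + \<eta> - 1)"
        using u eta by (intro powr_mono2') auto
      moreover have "(1 + u) powr (\<alpha> + \<eta> - 1) \<le> u powr (\<alpha> + \<eta> - 1)"
        using u eta by (intro powr_mono2') auto
      ultimately show "(1 + u) powr (\<alpha> + \<eta> - 1) \<le> (if u \<le> 1 then 1 else u powr (\<alpha> + \<eta> - 1))" by simp
    qed (use A A' in simp)
    finally have b2: "q (n + ?k) / scale n \<le> A * A' * (if u \<le> 1 then 1 else u powr (\<alpha> + \<eta> - 1))" .
    have "q ?k * q (n + ?k) / (scale n)\<^sup>2 = (q ?k / scale n) * (q (n + ?k) / scale n)"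
      by (simp add: power2_eq_square)
    also have "\<dots> \<le> (A * A' * (if u \<le> 1 then u powr (\<alpha> - \<eta> - 1) else u powr (\<alpha> + \<eta> - 1))) *
        (A * A' * (if u \<le> 1 then 1 else u powr (\<alpha> + \<eta> - 1)))"
      using b1 b2 sc q_nonneg A(1) A'(1) by (intro mult_mono) auto
    also have "\<dots> = (A * A')\<^sup>2 * (if u \<le> 1 then u powr (\<alpha> - \<eta> - 1) else u powr (2 * (\<alpha> + \<eta> - 1)))"
    proof (cases "u \<le> 1")
      case False
      have "u powr (\<alpha> + \<eta> - 1) * u powr (\<alpha> + \<eta> - 1) = u powr (2 * (\<alpha> + \<eta> - 1))"
        by (simp only: powr_add[symmetric] mult_2)
      then show ?thesis using False by (simp add: power2_eq_square mult_ac)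
    qed (simp add: power2_eq_square)
    finally show ?thesis .
  qed
  moreover have "(A * A')\<^sup>2 > 0" using A A' by simp
  ultimately show ?thesis by blast
qed

text \<open>Write the sum over \<open>k\<close> as an integral over \<open>u\<close> with \<open>k = \<lfloor>u n\<rfloor>\<close> and apply dominated
  convergence. The factors \<^term>\<open>w\<close> serve to truncate the sum.\<close>

lemma scaled_sum_limit:
  fixes w :: "nat \<Rightarrow> nat \<Rightarrow> real" and W :: "real \<Rightarrow> real"
  assumes w: "\<And>n k. 0 \<le> w n k" "\<And>n k. w n k \<le> 1"
    and W[measurable]: "W \<in> borel_measurable borel"
    and lim: "AE u in lborel. u > 0 \<longrightarrow> (\<lambda>n. w n (nat \<lfloor>u * real n\<rfloor>)) \<longlonglongrightarrow> W u"
  shows "(\<lambda>n. (\<Sum>k. w n k * (q k * q (n + k))) / (real n * (scale n)\<^sup>2)) \<longlonglongrightarrow>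
    C\<^sup>2 * (\<integral>u. indicator {0<..} u * (W u * (u powr (\<alpha> - 1) * (1 + u) powr (\<alpha> - 1))) \<partial>lborel)"
proof -
  obtain A where A: "A > 0" "\<And>n u. 1 \<le> n \<Longrightarrow> 0 < u \<Longrightarrow>
     q (nat \<lfloor>u * real n\<rfloor>) * q (n + nat \<lfloor>u * real n\<rfloor>) / (scale n)\<^sup>2 \<le>
     A * (if u \<le> 1 then u powr (\<alpha> - \<eta> - 1) else u powr (2 * (\<alpha> + \<eta> - 1)))"
    using q_product_dominated by metis
  define f where "f n k = w n k * (q k * q (n + k)) / (scale n)\<^sup>2" for n k
  define s where "s n u = indicator {0<..} u * f n (nat \<lfloor>u * real n\<rfloor>)" for n u
  let ?h = "\<lambda>u. C\<^sup>2 * (indicator {0<..} u * (W u * (u powr (\<alpha> - 1) * (1 + u) powr (\<alpha> - 1))))"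
  let ?G = "\<lambda>u. A * (indicator {0<..} u *
     (if u \<le> 1 then u powr (\<alpha> - \<eta> - 1) else u powr (2 * (\<alpha> + \<eta> - 1))))"
  have sc: "scale n > 0" if "n \<ge> 1" for n using that H_pos[of n] by (simp add: scale_def)
  have f_summable: "summable (\<lambda>k. \<bar>f n k\<bar>)" for n
  proof (rule summable_comparison_test)
    have "norm \<bar>f n k\<bar> \<le> q k * q (n + k) / (scale n)\<^sup>2" for k
    proof -
      have "w n k * (q k * q (n + k)) \<le> 1 * (q k * q (n + k))"
        using w q_nonneg by (intro mult_right_mono) auto
      then show ?thesis
        using w q_nonneg by (simp add: f_def abs_mult divide_right_mono)
    qed
    then show "\<exists>N. \<forall>k\<ge>N. norm \<bar>f n k\<bar> \<le> q k * q (n + k) / (scale n)\<^sup>2" by blast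
    show "summable (\<lambda>k. q k * q (n + k) / (scale n)\<^sup>2)"
      by (intro summable_divide summable_q_product)
  qed
  have sum_eq: "(\<Sum>k. w n k * (q k * q (n + k))) / (real n * (scale n)\<^sup>2) = (\<integral>u. s n u \<partial>lborel)"
    if n: "n \<ge> 1" for n
  proof -
    have "(\<integral>u. s n u \<partial>lborel) = (\<integral>u. indicator {0..} u * f n (nat \<lfloor>u * real n\<rfloor>) \<partial>lborel)"
      unfolding s_def
      by (rule integral_cong_AE) (measurable, use AE_lborel_singleton[of 0] in \<open>auto simp: indicator_def elim!: eventually_mono\<close>)
    also have "\<dots> = (\<Sum>k. f n k) / real n"
      using n by (intro scaled_step_integral f_summable) auto
    also have "(\<Sum>k. f n k) = (\<Sum>k. w n k * (q k * q (n + k))) / (scale n)\<^sup>2"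
    proof (unfold f_def, rule suminf_divide)
      have "summable (\<lambda>k. (scale n)\<^sup>2 * f n k)"
        by (intro summable_mult summable_rabs_cancel[OF f_summable])
      then show "summable (\<lambda>k. w n k * (q k * q (n + k)))"
        using sc[OF n] by (simp add: f_def)
    qed
    finally show ?thesis by (simp add: mult.commute)
  qed
  have "(\<lambda>n. \<integral>u. s (n + 1) u \<partial>lborel) \<longlonglongrightarrow> (\<integral>u. ?h u \<partial>lborel)"
  proof (rule integral_dominated_convergence)
    show "integrable lborel ?G"
      by (intro integrable_mult_right powr_majorant_integrable) (use eta in auto)
    show "AE u in lborel. norm (s (n + 1) u) \<le> ?G u" for n
    proof (rule AE_I2)
      fix u :: real
      let ?k = "nat \<lfloor>u * real (n + 1)\<rfloor>"
      show "norm (s (n + 1) u) \<le> ?G u"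
      proof (cases "u > 0")
        case True
        have "w (n + 1) ?k * (q ?k * q (n + 1 + ?k)) \<le> 1 * (q ?k * q (n + 1 + ?k))"
          using w q_nonneg by (intro mult_right_mono) auto
        then have "f (n + 1) ?k \<le> q ?k * q (n + 1 + ?k) / (scale (n + 1))\<^sup>2"
          unfolding f_def by (intro divide_right_mono) auto
        also have "\<dots> \<le> A * (if u \<le> 1 then u powr (\<alpha> - \<eta> - 1) else u powr (2 * (\<alpha> + \<eta> - 1)))"
          using True by (intro A(2)) auto
        finally have "f (n + 1) ?k \<le> A * (if u \<le> 1 then u powr (\<alpha> - \<eta> - 1) else u powr (2 * (\<alpha> + \<eta> - 1)))" .
        moreover have "0 \<le> f (n + 1) ?k" using w q_nonneg by (simp add: f_def)
        ultimately show ?thesis using True by (simp add: s_def)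
      qed (simp add: s_def)
    qed
    show "AE u in lborel. (\<lambda>n. s (n + 1) u) \<longlonglongrightarrow> ?h u"
      using lim
    proof eventually_elim
      case (elim u)
      show ?case
      proof (cases "u > 0")
        case True
        let ?k = "\<lambda>n. nat \<lfloor>u * real n\<rfloor>"
        have k: "(\<lambda>n. real (?k n) / real n) \<longlonglongrightarrow> u" by (rule floor_ratio_limit[OF True])
        have "(\<lambda>n. 1 + real (?k n) / real n) \<longlonglongrightarrow> 1 + u" by (intro tendsto_intros k)
        then have k': "(\<lambda>n. real (n + ?k n) / real n) \<longlonglongrightarrow> 1 + u"
          by (rule Lim_transform_eventually)
            (auto intro!: eventually_sequentiallyI[of 1] simp: add_divide_distrib)
        have "(\<lambda>n. w n (?k n) * ((q (?k n) / scale n) * (q (n + ?k n) / scale n))) \<longlonglongrightarrow>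
          W u * ((C * u powr (\<alpha> - 1)) * (C * (1 + u) powr (\<alpha> - 1)))"
          using elim True by (intro tendsto_mult q_scaled_limit k k') auto
        then have "(\<lambda>n. s n u) \<longlonglongrightarrow> ?h u"
          using True by (simp add: s_def f_def power2_eq_square mult_ac)
        then show ?thesis by (rule LIMSEQ_ignore_initial_segment)
      qed (simp add: s_def)
    qed
    show "(\<lambda>u. s (n + 1) u) \<in> borel_measurable lborel" for n
      unfolding s_def by measurable
  qed measurable
  then have "(\<lambda>n. \<integral>u. s n u \<partial>lborel) \<longlonglongrightarrow> (\<integral>u. ?h u \<partial>lborel)"
    by (rule LIMSEQ_offset)
  then have "(\<lambda>n. (\<Sum>k. w n k * (q k * q (n + k))) / (real n * (scale n)\<^sup>2)) \<longlonglongrightarrow> (\<integral>u. ?h u \<partial>lborel)"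
    by (rule Lim_transform_eventually) (auto intro!: eventually_sequentiallyI[of 1] simp: sum_eq)
  then show ?thesis by simp
qed

definition limit_cdf :: "real \<Rightarrow> real" where
  "limit_cdf x = (\<integral>u. indicator {0<..} u * (indicator {..x} u *
     (u powr (\<alpha> - 1) * (1 + u) powr (\<alpha> - 1))) \<partial>lborel) / Beta \<alpha> (1 - 2 * \<alpha>)"

lemma beta_pos: "Beta \<alpha> (1 - 2 * \<alpha>) > 0"
  using alpha by (auto simp: Beta_def intro!: divide_pos_pos mult_pos_pos)

lemma total_sum_limit:
  "(\<lambda>n. (\<Sum>k. q k * q (n + k)) / (real n * (scale n)\<^sup>2)) \<longlonglongrightarrow> C\<^sup>2 * Beta \<alpha> (1 - 2 * \<alpha>)"
  using scaled_sum_limit[of "\<lambda>_ _. 1" "\<lambda>_. 1"] beta_prime_integral(2)[OF alpha] by simp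

lemma total_sum_pos: "eventually (\<lambda>n. (\<Sum>k. q k * q (n + k)) > 0) at_top"
proof -
  have "0 < C\<^sup>2 * Beta \<alpha> (1 - 2 * \<alpha>)" using C_pos beta_pos by simp
  from order_tendstoD(1)[OF total_sum_limit this] eventually_ge_at_top[of 1]
  show ?thesis
  proof eventually_elim
    case (elim n)
    moreover have "real n * (scale n)\<^sup>2 > 0" using elim H_pos[of n] by (simp add: scale_def)
    ultimately show ?case by (simp add: zero_less_divide_iff)
  qed
qed

text \<open>The choice \<open>w n k = 1\<close> for \<open>k \<le> \<lfloor>x n\<rfloor>\<close> converges to the indicator of \<open>u \<le> x\<close>
  except at \<open>u = x\<close>. Dividing by the untruncated sum cancels the scale and the constant.\<close>

lemma truncated_sum_limit:
  assumes x: "x \<ge> 0"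
  shows "(\<lambda>n. (\<Sum>k\<le>nat \<lfloor>x * real n\<rfloor>. q k * q (n + k)) / (\<Sum>k. q k * q (n + k)))
    \<longlonglongrightarrow> limit_cdf x"
proof -
  define w :: "nat \<Rightarrow> nat \<Rightarrow> real" where "w n k = indicator {..nat \<lfloor>x * real n\<rfloor>} k" for n k
  have sum_eq: "(\<Sum>k. w n k * (q k * q (n + k))) = (\<Sum>k\<le>nat \<lfloor>x * real n\<rfloor>. q k * q (n + k))" for n
    by (subst suminf_finite[of "{..nat \<lfloor>x * real n\<rfloor>}"]) (auto simp: w_def)
  have "AE u in lborel. u \<noteq> x" by (rule AE_lborel_singleton)
  then have lim: "AE u in lborel. u > 0 \<longrightarrow> (\<lambda>n. w n (nat \<lfloor>u * real n\<rfloor>)) \<longlonglongrightarrow> indicator {..x} u"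
  proof eventually_elim
    case (elim u)
    show ?case
    proof
      assume u: "u > 0"
      show "(\<lambda>n. w n (nat \<lfloor>u * real n\<rfloor>)) \<longlonglongrightarrow> indicator {..x} u"
      proof (cases "u < x")
        case True
        have "nat \<lfloor>u * real n\<rfloor> \<le> nat \<lfloor>x * real n\<rfloor>" for n
          using True by (intro nat_mono floor_mono mult_right_mono) auto
        then show ?thesis using True by (simp add: w_def)
      next
        case False
        then have xu: "x < u" using elim by simp
        have ev: "eventually (\<lambda>n. 1 < (u - x) * real n) at_top"
        proof -
          have "filterlim (\<lambda>n. (u - x) * real n) at_top at_top"
            using xu by (intro filterlim_tendsto_pos_mult_at_top[OF tendsto_const] filterlim_real_sequentially) auto
          then show ?thesis by (simp add: filterlim_at_top_dense)
        qed
        then have "eventually (\<lambda>n. w n (nat \<lfloor>u * real n\<rfloor>) = 0) at_top"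
        proof eventually_elim
          case (elim n)
          have "\<lfloor>x * real n\<rfloor> < \<lfloor>u * real n\<rfloor>" using elim by (simp add: left_diff_distrib) linarith
          moreover have "0 \<le> \<lfloor>x * real n\<rfloor>" using x by simp
          ultimately have "\<not> nat \<lfloor>u * real n\<rfloor> \<le> nat \<lfloor>x * real n\<rfloor>" by linarith
          then show ?case by (simp add: w_def)
        qed
        then have "(\<lambda>n. w n (nat \<lfloor>u * real n\<rfloor>)) \<longlonglongrightarrow> 0" by (rule tendsto_eventually)
        then show ?thesis using xu by simp
      qed
    qed
  qed
  let ?I = "\<integral>u. indicator {0<..} u * (indicator {..x} u * (u powr (\<alpha> - 1) * (1 + u) powr (\<alpha> - 1))) \<partial>lborel"
  have "(\<lambda>n. (\<Sum>k. w n k * (q k * q (n + k))) / (real n * (scale n)\<^sup>2)) \<longlonglongrightarrow> C\<^sup>2 * ?I"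
    by (rule scaled_sum_limit[OF _ _ _ lim]) (auto simp: w_def indicator_def)
  then have L: "(\<lambda>n. ((\<Sum>k\<le>nat \<lfloor>x * real n\<rfloor>. q k * q (n + k)) / (real n * (scale n)\<^sup>2)) /
      ((\<Sum>k. q k * q (n + k)) / (real n * (scale n)\<^sup>2)))
    \<longlonglongrightarrow> (C\<^sup>2 * ?I) / (C\<^sup>2 * Beta \<alpha> (1 - 2 * \<alpha>))"
    unfolding sum_eq using C_pos beta_pos by (intro tendsto_divide total_sum_limit) auto
  have lim_eq: "(C\<^sup>2 * ?I) / (C\<^sup>2 * Beta \<alpha> (1 - 2 * \<alpha>)) = limit_cdf x"
    using C_pos by (simp add: limit_cdf_def)
  have ev: "eventually (\<lambda>n. ((\<Sum>k\<le>nat \<lfloor>x * real n\<rfloor>. q k * q (n + k)) / (real n * (scale n)\<^sup>2)) /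
      ((\<Sum>k. q k * q (n + k)) / (real n * (scale n)\<^sup>2)) =
      (\<Sum>k\<le>nat \<lfloor>x * real n\<rfloor>. q k * q (n + k)) / (\<Sum>k. q k * q (n + k))) at_top"
  proof (rule eventually_sequentiallyI[of 1])
    fix n :: nat assume "1 \<le> n"
    then have "real n * (scale n)\<^sup>2 \<noteq> 0" using H_pos[of n] by (simp add: scale_def)
    then show "((\<Sum>k\<le>nat \<lfloor>x * real n\<rfloor>. q k * q (n + k)) / (real n * (scale n)\<^sup>2)) /
      ((\<Sum>k. q k * q (n + k)) / (real n * (scale n)\<^sup>2)) =
      (\<Sum>k\<le>nat \<lfloor>x * real n\<rfloor>. q k * q (n + k)) / (\<Sum>k. q k * q (n + k))" by simp
  qed
  show ?thesis using Lim_transform_eventually[OF L ev] unfolding lim_eq .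
qed

end

section \<open>Undoing the convolution\<close>

text \<open>The meeting probabilities \<open>p n\<close>, known only through their convolution with the squared
  weights. Since these are summable, all but a small part of the mass is displaced by a bounded amount,
  which is invisible on the scale \<open>n\<close>: partial sums of \<open>p n\<close> inherit the limit of the partial sums of the
  products.\<close>

locale convolution_weights = regular_weights +
  fixes p :: "nat \<Rightarrow> nat \<Rightarrow> real"
  assumes p_nonneg: "\<And>n e. p n e \<ge> 0"
    and p_summable: "\<And>n. summable (p n)"
    and q_0: "q 0 = 1"
    and convolution: "\<And>n k. q k * q (n + k) = (\<Sum>e\<le>k. p n e * (q (k - e))\<^sup>2)"
begin

abbreviation square_sum :: "nat \<Rightarrow> real" where "square_sum m \<equiv> \<Sum>j\<le>m. (q j)\<^sup>2"
abbreviation square_total :: real where "square_total \<equiv> \<Sum>j. (q j)\<^sup>2"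

lemma square_sum_ge_1: "1 \<le> square_sum m"
proof -
  have "(\<Sum>j\<in>{0}. (q j)\<^sup>2) \<le> square_sum m" by (intro sum_mono2) auto
  then show ?thesis by (simp add: q_0)
qed

lemma square_sum_le_total: "square_sum m \<le> square_total"
  by (intro sum_le_suminf summable_q_square) auto

lemma truncated_sum_convolution:
  "(\<Sum>k\<le>m. q k * q (n + k)) = (\<Sum>e\<le>m. p n e * square_sum (m - e))"
proof -
  have "(\<Sum>k\<le>m. q k * q (n + k)) = (\<Sum>(e, j)\<in>{(e, j). e + j \<le> m}. p n e * (q j)\<^sup>2)"
    by (simp add: convolution sum.triangle_reindex_eq)
  also have "{(e, j). e + j \<le> m} = (SIGMA e:{..m}. {..m - e})" by auto
  also have "(\<Sum>(e, j)\<in>(SIGMA e:{..m}. {..m - e}). p n e * (q j)\<^sup>2) =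
      (\<Sum>e\<le>m. p n e * square_sum (m - e))"
    by (subst sum.Sigma[symmetric]) (auto simp: sum_distrib_left)
  finally show ?thesis .
qed

lemma truncated_sum_le: "(\<Sum>k\<le>m. q k * q (n + k)) \<le> square_total * (\<Sum>e\<le>m. p n e)"
proof -
  have "(\<Sum>e\<le>m. p n e * square_sum (m - e)) \<le> (\<Sum>e\<le>m. p n e * square_total)"
    by (intro sum_mono mult_left_mono square_sum_le_total p_nonneg)
  also have "\<dots> = square_total * (\<Sum>e\<le>m. p n e)"
    by (subst mult.commute) (rule sum_distrib_right[symmetric])
  finally show ?thesis unfolding truncated_sum_convolution .
qed

text \<open>Room for \<open>K\<close> further steps lets every \<open>e \<le> m\<close> collect at least the squares up
  to index \<open>K\<close>.\<close>

lemma truncated_sum_ge: "square_sum K * (\<Sum>e\<le>m. p n e) \<le> (\<Sum>k\<le>m + K. q k * q (n + k))"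
proof -
  have "square_sum K * (\<Sum>e\<le>m. p n e) = (\<Sum>e\<le>m. p n e * square_sum K)"
    by (subst mult.commute) (rule sum_distrib_right)
  also have "\<dots> \<le> (\<Sum>e\<le>m. p n e * square_sum (m + K - e))"
    by (intro sum_mono mult_left_mono sum_mono2 p_nonneg) auto
  also have "\<dots> \<le> (\<Sum>e\<le>m + K. p n e * square_sum (m + K - e))"
    by (intro sum_mono2 mult_nonneg_nonneg p_nonneg sum_nonneg) auto
  finally show ?thesis unfolding truncated_sum_convolution .
qed

lemma total_sum_convolution: "(\<Sum>k. q k * q (n + k)) = (\<Sum>e. p n e) * square_total"
proof -
  have "(\<lambda>k. \<Sum>e\<le>k. p n e * (q (k - e))\<^sup>2) sums ((\<Sum>e. p n e) * square_total)"
    using p_summable summable_q_square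
    by (intro Cauchy_product_sums) (simp_all add: abs_of_nonneg p_nonneg)
  then show ?thesis by (simp add: convolution sums_iff)
qed

lemma p_total_pos: "eventually (\<lambda>n. (\<Sum>e. p n e) > 0) at_top"
  using total_sum_pos
proof eventually_elim
  case (elim n)
  moreover have "square_total > 0" using square_sum_ge_1[of 0] square_sum_le_total[of 0] by linarith
  ultimately show ?case unfolding total_sum_convolution by (simp add: zero_less_mult_iff)
qed

text \<open>Squeeze the quotient between the quotient of truncated sums at \<open>x\<close> and, up to a factor tending
  to \<open>1\<close>, the one at \<open>x + \<epsilon>\<close>.\<close>

lemma normalised_partial_sum_limit:
  assumes x: "x \<ge> 0" and cont: "isCont limit_cdf x"
  shows "(\<lambda>n. (\<Sum>e\<le>nat \<lfloor>x * real n\<rfloor>. p n e) / (\<Sum>e. p n e)) \<longlonglongrightarrow> limit_cdf x"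
proof -
  let ?S = "\<lambda>n x. (\<Sum>k\<le>nat \<lfloor>x * real n\<rfloor>. q k * q (n + k))"
  let ?T = "\<lambda>n. \<Sum>k. q k * q (n + k)"
  let ?P = "\<lambda>n. \<Sum>e\<le>nat \<lfloor>x * real n\<rfloor>. p n e"
  let ?U = "\<lambda>n. \<Sum>e. p n e"
  have Qpos: "square_total > 0" using square_sum_ge_1[of 0] square_sum_le_total[of 0] by linarith
  show ?thesis
  proof (rule order_tendstoI)
    fix y assume "y < limit_cdf x"
    from order_tendstoD(1)[OF truncated_sum_limit[OF x] this] p_total_pos
    show "eventually (\<lambda>n. y < ?P n / ?U n) at_top"
    proof eventually_elim
      case (elim n)
      have "?S n x / ?T n \<le> (square_total * ?P n) / ?T n"
        using elim(2) Qpos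
        by (intro divide_right_mono truncated_sum_le) (simp add: total_sum_convolution)
      also have "\<dots> = ?P n / ?U n"
        using Qpos by (simp add: total_sum_convolution)
      finally show ?case using elim(1) by linarith
    qed
  next
    fix y assume y: "limit_cdf x < y"
    have "eventually (\<lambda>z. limit_cdf z < y) (at_right x)"
      using cont y unfolding isCont_def filterlim_at_split by (auto intro: order_tendstoD)
    then obtain b where b: "b > x" "\<And>z. x < z \<Longrightarrow> z < b \<Longrightarrow> limit_cdf z < y"
      unfolding eventually_at_right_field by blast
    define \<epsilon> where "\<epsilon> = (b - x) / 2"
    have e: "\<epsilon> > 0" "limit_cdf (x + \<epsilon>) < y" using b by (auto simp: \<epsilon>_def field_simps)
    \<comment> \<open>The room \<open>K\<close> is taken to be \<open>\<lfloor>\<epsilon> n\<rfloor>\<close>, so that the loss factor tends to \<open>1\<close>.\<close>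
    have "filterlim (\<lambda>n. nat \<lfloor>\<epsilon> * real n\<rfloor>) at_top at_top"
    proof -
      have "filterlim (\<lambda>n. \<epsilon> * real n) at_top at_top"
        using e by (intro filterlim_tendsto_pos_mult_at_top[OF tendsto_const] filterlim_real_sequentially) auto
      then show ?thesis
        by (intro filterlim_compose[OF filterlim_nat_sequentially] filterlim_compose[OF filterlim_floor_sequentially])
    qed
    then have "(\<lambda>n. square_sum (nat \<lfloor>\<epsilon> * real n\<rfloor>)) \<longlonglongrightarrow> square_total"
      by (rule filterlim_compose[OF summable_LIMSEQ'[OF summable_q_square]])
    then have "(\<lambda>n. square_total / square_sum (nat \<lfloor>\<epsilon> * real n\<rfloor>) * (?S n (x + \<epsilon>) / ?T n))
        \<longlonglongrightarrow> square_total / square_total * limit_cdf (x + \<epsilon>)"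
      using e x Qpos by (intro tendsto_intros truncated_sum_limit) auto
    then have "(\<lambda>n. square_total / square_sum (nat \<lfloor>\<epsilon> * real n\<rfloor>) * (?S n (x + \<epsilon>) / ?T n))
        \<longlonglongrightarrow> limit_cdf (x + \<epsilon>)"
      using Qpos by simp
    from order_tendstoD(2)[OF this e(2)] p_total_pos
    show "eventually (\<lambda>n. ?P n / ?U n < y) at_top"
    proof eventually_elim
      case (elim n)
      let ?K = "nat \<lfloor>\<epsilon> * real n\<rfloor>"
      have K: "square_sum ?K > 0" using square_sum_ge_1[of ?K] by linarith
      have "nat \<lfloor>x * real n\<rfloor> + ?K \<le> nat \<lfloor>(x + \<epsilon>) * real n\<rfloor>"
      proof -
        have "\<lfloor>x * real n\<rfloor> + \<lfloor>\<epsilon> * real n\<rfloor> \<le> \<lfloor>(x + \<epsilon>) * real n\<rfloor>"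
          by (simp add: distrib_right le_floor_add)
        moreover have "0 \<le> \<lfloor>x * real n\<rfloor>" "0 \<le> \<lfloor>\<epsilon> * real n\<rfloor>" using x e by auto
        ultimately show ?thesis by linarith
      qed
      then have "(\<Sum>k\<le>nat \<lfloor>x * real n\<rfloor> + ?K. q k * q (n + k)) \<le> ?S n (x + \<epsilon>)"
        by (intro sum_mono2 mult_nonneg_nonneg q_nonneg) auto
      then have "square_sum ?K * ?P n \<le> ?S n (x + \<epsilon>)"
        using truncated_sum_ge[of ?K n "nat \<lfloor>x * real n\<rfloor>"] by linarith
      then have "?P n \<le> ?S n (x + \<epsilon>) / square_sum ?K"
        using K by (simp add: pos_le_divide_eq mult.commute)
      then have "?P n / ?U n \<le> ?S n (x + \<epsilon>) / square_sum ?K / ?U n"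
        using elim(2) by (intro divide_right_mono) auto
      also have "\<dots> = square_total / square_sum ?K * (?S n (x + \<epsilon>) / ?T n)"
        using Qpos by (simp add: total_sum_convolution)
      finally show ?case using elim(1) by linarith
    qed
  qed
qed

end

section \<open>Convergence of the conditional law\<close>

text \<open>The tail is positive far out, hence everywhere by monotonicity, and never exceeds \<open>1\<close>. Its
  reciprocal inherits regular variation from \<open>n powr \<alpha> / L n\<close>, at integer factors, where both
  \<open>n\<close> and \<open>c * n\<close> are arguments of the tail.\<close>

lemma inverse_tail_regular:
  fixes \<mu> :: "nat pmf"
  defines "H \<equiv> \<lambda>n. inverse (measure (measure_pmf \<mu>) {n..})"
  assumes L: "slowly_varying L"
    and tail: "(\<lambda>n. measure (measure_pmf \<mu>) {n..}) \<sim>[at_top] (\<lambda>n. real n powr (-\<alpha>) * L (real n))"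
  shows "mono H" and "H n \<ge> 1"
    and "c > 0 \<Longrightarrow> (\<lambda>n. H (c * n) / H n) \<longlonglongrightarrow> real c powr \<alpha>"
    and "(\<lambda>n. real n powr (-\<alpha>) * L (real n) * H n) \<longlonglongrightarrow> 1"
proof -
  let ?F = "\<lambda>n. measure (measure_pmf \<mu>) {n..}"
  let ?g = "\<lambda>n. real n powr (-\<alpha>) * L (real n)"
  have Lpos: "L x > 0" for x using L by (simp add: slowly_varying_def)
  have ratio: "(\<lambda>n. ?F n / ?g n) \<longlonglongrightarrow> 1"
  proof (rule asymp_equivD_strong[OF tail], rule eventually_sequentiallyI[of 1])
    fix n :: nat assume "1 \<le> n"
    then show "?F n \<noteq> 0 \<or> ?g n \<noteq> 0" using Lpos[of "real n"] by simp
  qed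
  have anti: "?F n \<le> ?F m" if "m \<le> n" for m n
    using that by (intro measure_pmf.finite_measure_mono) auto
  have "eventually (\<lambda>n. 0 < ?F n / ?g n) at_top"
    by (rule order_tendstoD(1)[OF ratio]) simp
  then obtain N where "\<And>n. n \<ge> N \<Longrightarrow> 0 < ?F n / ?g n"
    unfolding eventually_at_top_linorder by blast
  then have "?F n > 0" if "n \<ge> N" for n
    using that measure_nonneg[of "measure_pmf \<mu>" "{n..}"] by (fastforce simp: zero_less_divide_iff)
  then have Fpos: "?F n > 0" for n
    using anti[of n "max n N"] by (smt (verit) max.cobounded1 max.cobounded2)
  show "mono H" unfolding H_def mono_def using anti Fpos by (auto intro!: le_imp_inverse_le)
  show "H n \<ge> 1" unfolding H_def using Fpos[of n] measure_pmf.prob_le_1[of \<mu> "{n..}"]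
    by (intro one_le_inverse) auto
  have inv: "inverse (?F n / ?g n) = ?g n * H n" for n
    by (simp add: H_def divide_inverse)
  have "(\<lambda>n. inverse (?F n / ?g n)) \<longlonglongrightarrow> inverse 1"
    by (intro tendsto_inverse ratio) simp
  then show gH: "(\<lambda>n. ?g n * H n) \<longlonglongrightarrow> 1" unfolding inv by simp
  show "(\<lambda>n. H (c * n) / H n) \<longlonglongrightarrow> real c powr \<alpha>" if c: "c > 0"
  proof -
    have cn: "filterlim (\<lambda>n. c * n) at_top at_top"
      using c by (intro mult_nat_left_at_top)
    have "((\<lambda>x. L (real c * x) / L x) \<longlongrightarrow> 1) at_top"
      using L c by (simp add: slowly_varying_def)
    then have Llim: "(\<lambda>n. L (real c * real n) / L (real n)) \<longlonglongrightarrow> 1"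
      by (rule filterlim_compose[OF _ filterlim_real_sequentially])
    have lim: "(\<lambda>n. (?g (c * n) * H (c * n)) / (?g n * H n) * real c powr \<alpha> /
        (L (real c * real n) / L (real n))) \<longlonglongrightarrow> 1 / 1 * real c powr \<alpha> / 1"
      by (intro tendsto_intros Llim gH filterlim_compose[OF gH cn]) simp_all
    have "eventually (\<lambda>n. (?g (c * n) * H (c * n)) / (?g n * H n) * real c powr \<alpha> /
        (L (real c * real n) / L (real n)) = H (c * n) / H n) at_top"
    proof (rule eventually_sequentiallyI[of 1])
      fix n :: nat assume n: "1 \<le> n"
      have "real (c * n) powr (-\<alpha>) = real n powr (-\<alpha>) / real c powr \<alpha>"
        using powr_mult[of "real c" "real n" "-\<alpha>"] by (simp add: powr_minus_divide)
      moreover have "real n powr (-\<alpha>) > 0" "real c powr \<alpha> > 0" using n c by simp_all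
      ultimately show "(?g (c * n) * H (c * n)) / (?g n * H n) * real c powr \<alpha> /
        (L (real c * real n) / L (real n)) = H (c * n) / H n"
        using Lpos[of "real n"] Lpos[of "real c * real n"] by simp
    qed
    from Lim_transform_eventually[OF lim this] show ?thesis by simp
  qed
qed

theorem proposition2p5:
  fixes \<alpha> :: real and L :: "real \<Rightarrow> real" and \<mu> :: "nat pmf"
    and M :: "'a measure" and R :: "int \<Rightarrow> 'a \<Rightarrow> nat"
  assumes alpha: "0 < \<alpha>" "\<alpha> < 1/2"
    and L: "slowly_varying L"
    and mu_pos: "0 \<notin> set_pmf \<mu>"
    and tail: "(\<lambda>n. measure (measure_pmf \<mu>) {n..}) \<sim>[at_top] (\<lambda>n. real n powr (-\<alpha>) * L (real n))"
    and aperiodic: "Gcd {n. pmf \<mu> n > 0} = 1"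
    and renewal: "(\<lambda>n. renewal_weight \<mu> n) \<sim>[at_top]
       (\<lambda>n. 1 / (Gamma \<alpha> * Gamma (1 - \<alpha>)) * (real n powr (\<alpha> - 1) / L (real n)))"
    and M: "prob_space M"
    and indep: "prob_space.indep_vars M (\<lambda>_. count_space UNIV) R UNIV"
    and law: "\<And>i. distr M (count_space UNIV) (R i) = measure_pmf \<mu>"
  shows "weak_conv_m
     (\<lambda>n. distr (uniform_measure M {\<omega> \<in> space M. same_component (\<lambda>i. R i \<omega>) 0 (int n)}) borel
            (\<lambda>\<omega>. real_of_ereal (mrca_depth (\<lambda>i. R i \<omega>) n) / real n))
     (density lborel (\<lambda>x. ennreal (indicator {0<..} x *
            (inverse (Beta \<alpha> (1 - 2 * \<alpha>)) * x powr (\<alpha> - 1) * (1 + x) powr (\<alpha> - 1)))))"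
proof -
  interpret prob_space M by fact
  interpret renewal_graph M \<mu> R
    by unfold_locales (use mu_pos indep law in auto)
  define H where "H n = inverse (measure (measure_pmf \<mu>) {n..})" for n
  define C where "C = 1 / (Gamma \<alpha> * Gamma (1 - \<alpha>))"
  note H = inverse_tail_regular[OF L tail, folded H_def]
  have C: "C > 0" using alpha by (simp add: C_def Gamma_real_pos)
  have Lpos: "L x > 0" for x using L by (simp add: slowly_varying_def)
  have Hpos: "H n > 0" for n using H(2)[of n] by linarith
  have q_asymp: "(\<lambda>n. renewal_weight \<mu> n * real n / H n) \<longlonglongrightarrow> C"
  proof -
    let ?g = "\<lambda>n. real n powr (-\<alpha>) * L (real n)"
    let ?h = "\<lambda>n. C * (real n powr (\<alpha> - 1) / L (real n))"
    have "(\<lambda>n. renewal_weight \<mu> n / ?h n) \<longlonglongrightarrow> 1"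
    proof (rule asymp_equivD_strong[OF renewal[folded C_def]], rule eventually_sequentiallyI[of 1])
      fix n :: nat assume "1 \<le> n"
      then show "renewal_weight \<mu> n \<noteq> 0 \<or> ?h n \<noteq> 0" using Lpos[of "real n"] C by simp
    qed
    then have lim: "(\<lambda>n. renewal_weight \<mu> n / ?h n * C / (?g n * H n)) \<longlonglongrightarrow> 1 * C / 1"
      by (intro tendsto_intros H(4)) auto
    have "eventually (\<lambda>n. renewal_weight \<mu> n / ?h n * C / (?g n * H n) =
        renewal_weight \<mu> n * real n / H n) at_top"
    proof (rule eventually_sequentiallyI[of 1])
      fix n :: nat assume n: "1 \<le> n"
      have "real n powr (\<alpha> - 1) * real n powr (-\<alpha>) = 1 / real n"
      proof -
        have "real n powr (\<alpha> - 1) * real n powr (-\<alpha>) = real n powr (\<alpha> - 1 + -\<alpha>)"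
          by (rule powr_add[symmetric])
        then show ?thesis using n by (simp add: powr_neg_one)
      qed
      then have "?h n * (?g n * H n) = C * H n / real n"
        using Lpos[of "real n"] by (simp add: field_simps)
      moreover have "renewal_weight \<mu> n / ?h n * C / (?g n * H n) =
          renewal_weight \<mu> n * C / (?h n * (?g n * H n))" by simp
      ultimately show "renewal_weight \<mu> n / ?h n * C / (?g n * H n) =
        renewal_weight \<mu> n * real n / H n" using C by simp
    qed
    from Lim_transform_eventually[OF lim this] show ?thesis by simp
  qed
  interpret W: convolution_weights "renewal_weight \<mu>" H \<alpha> C depth_prob
  proof
    show "summable (depth_prob n)" for n using depth_prob_sums[of n] by (rule sums_summable)
    show "renewal_weight \<mu> k * renewal_weight \<mu> (n + k) =
        (\<Sum>e\<le>k. depth_prob n e * (renewal_weight \<mu> (k - e))\<^sup>2)" for n k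
      by (rule renewal_product_convolution)
  qed (use alpha H C q_asymp in \<open>auto simp: renewal_weight_nonneg renewal_weight_0 depth_prob_def\<close>)
  let ?d = "\<lambda>x. indicator {0<..} x *
            (inverse (Beta \<alpha> (1 - 2 * \<alpha>)) * x powr (\<alpha> - 1) * (1 + x) powr (\<alpha> - 1))"
  let ?\<nu> = "density lborel (\<lambda>x. ennreal (?d x)) :: real measure"
  have cdf_eq: "cdf ?\<nu> x = W.limit_cdf x" for x
  proof -
    have d: "integrable lborel ?d"
      using integrable_mult_right[OF beta_prime_integral(1)[OF alpha], of "inverse (Beta \<alpha> (1 - 2 * \<alpha>))"]
      by (simp add: mult_ac)
    have dpos: "0 \<le> ?d u" for u using W.beta_pos by simp
    have int: "integrable lborel (\<lambda>u. ?d u * indicator {..x} u)"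
      by (rule integrable_real_mult_indicator[OF _ d]) simp
    have "emeasure ?\<nu> {..x} = (\<integral>\<^sup>+u. ennreal (?d u * indicator {..x} u) \<partial>lborel)"
      by (subst emeasure_density) (auto intro!: nn_integral_cong simp: indicator_def)
    also have "\<dots> = ennreal (\<integral>u. ?d u * indicator {..x} u \<partial>lborel)"
      using dpos by (intro nn_integral_eq_integral int) (auto simp: indicator_def)
    also have "(\<integral>u. ?d u * indicator {..x} u \<partial>lborel) = W.limit_cdf x"
      unfolding W.limit_cdf_def divide_inverse
      by (subst integral_mult_left_zero[symmetric]) (simp add: mult_ac)
    finally have "emeasure ?\<nu> {..x} = ennreal (W.limit_cdf x)" .
    moreover have "0 \<le> W.limit_cdf x"
      unfolding W.limit_cdf_def using W.beta_pos by (intro divide_nonneg_pos integral_nonneg) auto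
    ultimately show ?thesis by (simp add: cdf_def measure_def)
  qed
  show ?thesis
    unfolding weak_conv_m_def weak_conv_def
  proof (intro allI impI)
    have cdf_fun: "cdf ?\<nu> = W.limit_cdf" by (rule ext) (rule cdf_eq)
    fix x assume "isCont (cdf ?\<nu>) x"
    then have cont: "isCont W.limit_cdf x" unfolding cdf_fun .
    define G where "G n = (if x < 0 then 0 else
      (\<Sum>e\<le>nat \<lfloor>x * real n\<rfloor>. depth_prob n e) / (\<Sum>e. depth_prob n e))" for n
    have "G \<longlonglongrightarrow> W.limit_cdf x"
    proof (cases "x < 0")
      case True
      then have "(\<lambda>u. indicator {0<..} u * (indicator {..x} u *
          (u powr (\<alpha> - 1) * (1 + u) powr (\<alpha> - 1)))) = (\<lambda>_. 0 :: real)"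
        by (auto simp: fun_eq_iff indicator_def)
      then have "W.limit_cdf x = 0" by (simp add: W.limit_cdf_def)
      then show ?thesis using True by (simp add: G_def[abs_def])
    next
      case False
      then show ?thesis using W.normalised_partial_sum_limit[of x] cont by (simp add: G_def[abs_def])
    qed
    moreover have "eventually (\<lambda>n. G n =
        cdf (distr (uniform_measure M (connected_event n)) borel (scaled_depth n)) x) at_top"
      using W.p_total_pos eventually_gt_at_top[of 0]
      by eventually_elim (simp add: cdf_scaled_depth G_def)
    ultimately show "(\<lambda>n. cdf (distr (uniform_measure M (connected_event n)) borel (scaled_depth n)) x)
        \<longlonglongrightarrow> cdf ?\<nu> x"
      unfolding cdf_eq by (rule Lim_transform_eventually)
  qed
qed

end
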